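(* Fix $\alpha\in\left(0,\frac12\right)$ and $C>0$, and suppose that $1<pn^\alpha<C$ for all sufficiently large $n$. Then for every $\varepsilon>0$ there exists $n_0$ such that for all $n\ge n_0$, both $u_2(n,p)$ and $u_2'(n,p)$ are at least $\left(2-2\alpha-\varepsilon\right)\frac{\ln n}{p}$.
   Context: $G(n,p)$ is the Erdős–Rényi random graph on $n$ labelled vertices (vertex set $V$), each edge present independently with probability $p=p(n)$; $\mathbb{P}_{n,p}$ is the corresponding probability. A diameter graph in $\mathbb{R}^d$ is a graph $(V,E)$ with $V\subset\mathbb{R}^d$ finite and $E=\{\{\mathbf{x},\mathbf{y}\}\subseteq V: |\mathbf{x}-\mathbf{y}|=\operatorname{diam}V\}$, where $\operatorname{diam}V=\max_{\mathbf{x},\mathbf{y}\in V}|\mathbf{x}-\mathbf{y}|$ (Euclidean norm); a graph is a diameter graph in $\mathbb{R}^d$ if it is isomorphic to one. $u_d(n,p)$ is the largest positive integer $k$ such that $\mathbb{P}_{n,p}\big(\exists W\subseteq V,\ |W|=k,\ G[W]$ is a diameter graph in $\mathbb{R}^d$ and $\chi(G[W])=d+1\big)>\frac12$, where $G[W]$ is the induced subgraph; if no such $k$ exists, $u_d(n,p)=0$. $u_d'(n,p)$ is defined identically with the additional requirement that $G[W]$ be connected. *)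

theory Defs
  imports "HOL-Analysis.Analysis"
begin

text \<open>Graphs on the labelled vertex set V = {0..<n}; a graph is given by its edge set,
  a set of 2-element subsets of V.\<close>

definition all_edges :: "nat \<Rightarrow> nat set set" where
  "all_edges n = {{i, j} | i j. i < n \<and> j < n \<and> i \<noteq> j}"

definition prob_G :: "nat \<Rightarrow> real \<Rightarrow> (nat set set \<Rightarrow> bool) \<Rightarrow> real" where
  "prob_G n p Q = (\<Sum>E \<in> Pow (all_edges n).
      if Q E then p ^ card E * (1 - p) ^ (card (all_edges n) - card E) else 0)"

definition induced_edges :: "nat set set \<Rightarrow> nat set \<Rightarrow> nat set set" where
  "induced_edges E W = {e \<in> E. e \<subseteq> W}"

definition is_diameter_graph :: "'a::euclidean_space itself \<Rightarrow> nat set \<Rightarrow> nat set set \<Rightarrow> bool" where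
  "is_diameter_graph _ W F \<longleftrightarrow> finite W \<and>
     (\<exists>f :: nat \<Rightarrow> 'a. inj_on f W \<and>
        (\<forall>x\<in>W. \<forall>y\<in>W. x \<noteq> y \<longrightarrow> ({x, y} \<in> F \<longleftrightarrow> dist (f x) (f y) = diameter (f ` W))))"

definition chromatic_number :: "nat set \<Rightarrow> nat set set \<Rightarrow> nat" where
  "chromatic_number W F = (LEAST k. \<exists>c :: nat \<Rightarrow> nat. (\<forall>x\<in>W. c x < k) \<and>
       (\<forall>x\<in>W. \<forall>y\<in>W. {x, y} \<in> F \<and> x \<noteq> y \<longrightarrow> c x \<noteq> c y))"

definition graph_connected :: "nat set \<Rightarrow> nat set set \<Rightarrow> bool" where
  "graph_connected W F \<longleftrightarrow>
     (\<forall>x\<in>W. \<forall>y\<in>W. (\<lambda>a b. a \<in> W \<and> b \<in> W \<and> {a, b} \<in> F)\<^sup>*\<^sup>* x y)"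

definition good_event :: "'a::euclidean_space itself \<Rightarrow> bool \<Rightarrow> nat \<Rightarrow> nat \<Rightarrow> nat set set \<Rightarrow> bool" where
  "good_event T conn n k E \<longleftrightarrow> (\<exists>W \<subseteq> {..<n}. card W = k \<and>
      is_diameter_graph T W (induced_edges E W) \<and>
      chromatic_number W (induced_edges E W) = DIM('a) + 1 \<and>
      (conn \<longrightarrow> graph_connected W (induced_edges E W)))"

definition u_gen :: "'a::euclidean_space itself \<Rightarrow> bool \<Rightarrow> nat \<Rightarrow> real \<Rightarrow> nat" where
  "u_gen T conn n p = (let S = {k. 0 < k \<and> prob_G n p (good_event T conn n k) > 1/2}
                        in if S = {} then 0 else Max S)"

abbreviation u_d :: "'a::euclidean_space itself \<Rightarrow> nat \<Rightarrow> real \<Rightarrow> nat" where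
  "u_d T n p \<equiv> u_gen T False n p"
abbreviation u_d' :: "'a::euclidean_space itself \<Rightarrow> nat \<Rightarrow> real \<Rightarrow> nat" where
  "u_d' T n p \<equiv> u_gen T True n p"

end

theory Submission
  imports Defs
begin

text \<open>An odd cycle with arbitrarily many pendant vertices attached to it is a connected
  3-chromatic diameter graph in the plane: the cycle is a regular star polygon, and the pendant
  vertices at w lie on the arc of the Reuleaux polygon opposite w. It therefore suffices to find
  such a graph with k = (2 - 2 \<alpha> - 4 \<delta>) ln n / p pendant vertices as an induced subgraph of
  G(n,p).

  The cycle has about 2 n^(\<alpha> - \<delta>) vertices. It is found by exposing disjoint blocks of vertices
  one after the other: every block contains, with probability close to 1, a vertex whose only
  neighbour on the current induced path is its endpoint, and since n p^2 tends to infinity a last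
  large block contains a vertex that closes the path. About n^(1 - \<delta>) vertices have exactly one
  neighbour on the cycle, and among them an independent set of size k is found by the second moment
  method, with each of its vertices restricted to a block of its own. The sum over the overlaps
  converges because k^2 is much smaller than n^(1 - \<delta>), which is where \<alpha> < 1/2 is used again.\<close>

subsection \<open>Finite products of Bernoulli measures\<close>

text \<open>The rate 2 - 2 \<alpha> comes from a balance in the pendant step. A block of n / (2 k)
  vertices holds about n^(1 - \<delta>) / k candidates, roughly n^(1 - \<alpha> - \<delta>), and
  independence of the k chosen ones costs each of them a factor of about exp(- p k / 2). So p k can
  come close to 2 (1 - \<alpha> - \<delta>) ln n; giving up 4 \<delta> in place of 2 \<delta> leaves
  a factor n^(- \<delta>) to spare. This forces a long cycle: one of bounded length has only about n
  p neighbours, and the same balance would stop at 2 - 4 \<alpha>. On the other hand its length must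
  stay below 1 / p, so that a vertex misses all but one of its vertices at constant cost; a length
  times p of order n^(- \<delta>) meets both demands. Each round may look only at edges not seen
  before. Hence \<open>bern\<close> is a measure on an arbitrary finite set of potential edges, and
  the cycle and the pendant vertices live in different halves of the vertex set.\<close>

definition bern :: "'a set \<Rightarrow> real \<Rightarrow> ('a set \<Rightarrow> bool) \<Rightarrow> real" where
  "bern F p Q = (\<Sum>E \<in> Pow F. if Q E then p ^ card E * (1 - p) ^ (card F - card E) else 0)"

lemma prob_G_eq_bern: "prob_G n p Q = bern (all_edges n) p Q"
  by (simp add: prob_G_def bern_def)

lemma bern_nonneg: "0 \<le> p \<Longrightarrow> p \<le> 1 \<Longrightarrow> 0 \<le> bern F p Q"
  unfolding bern_def by (intro sum_nonneg) auto

lemma bern_mono: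
  assumes "0 \<le> p" "p \<le> 1" "\<And>E. E \<subseteq> F \<Longrightarrow> Q E \<Longrightarrow> Q' E"
  shows "bern F p Q \<le> bern F p Q'"
  unfolding bern_def using assms by (intro sum_mono) auto

lemma bern_cong:
  assumes "\<And>E. E \<subseteq> F \<Longrightarrow> Q E \<longleftrightarrow> Q' E"
  shows "bern F p Q = bern F p Q'"
  unfolding bern_def using assms by (intro sum.cong) auto

text \<open>Fubini for the product measure: the weight of \<open>E \<union> E'\<close> factors over
  the disjoint sets. The inner \<open>bern\<close> is the law of the unexposed edges given the
  exposed part \<open>E\<close>.\<close>

lemma bern_split:
  assumes fin: "finite F" "finite G" and disj: "F \<inter> G = {}"
  shows "bern (F \<union> G) p Q =
    (\<Sum>E\<in>Pow F. p ^ card E * (1 - p) ^ (card F - card E) * bern G p (\<lambda>E'. Q (E \<union> E')))"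
proof -
  have im: "Pow (F \<union> G) = (\<lambda>(E, E'). E \<union> E') ` (Pow F \<times> Pow G)"
  proof (intro equalityI subsetI)
    fix E assume "E \<in> Pow (F \<union> G)"
    then have "E = (E \<inter> F) \<union> (E \<inter> G)" by auto
    then show "E \<in> (\<lambda>(E, E'). E \<union> E') ` (Pow F \<times> Pow G)" by (intro image_eqI[of _ _ "(E \<inter> F, E \<inter> G)"]) auto
  qed auto
  have inj: "inj_on (\<lambda>(E, E'). E \<union> E') (Pow F \<times> Pow G)"
    using disj by (auto simp: inj_on_def) blast+
  have w: "p ^ card (E \<union> E') * (1 - p) ^ (card (F \<union> G) - card (E \<union> E')) =
      p ^ card E * (1 - p) ^ (card F - card E) * (p ^ card E' * (1 - p) ^ (card G - card E'))"
    if "E \<subseteq> F" "E' \<subseteq> G" for E E'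
  proof -
    have f: "finite E" "finite E'" using that fin finite_subset by auto
    have "card (E \<union> E') = card E + card E'" using that disj f by (intro card_Un_disjoint) auto
    moreover have "card (F \<union> G) = card F + card G" using disj fin by (intro card_Un_disjoint) auto
    moreover have "card E \<le> card F" "card E' \<le> card G" using that fin by (auto intro: card_mono)
    moreover from this have "card F + card G - (card E + card E') = (card F - card E) + (card G - card E')" by simp
    ultimately show ?thesis by (simp only: power_add mult_ac)
  qed
  show ?thesis
    unfolding bern_def im sum.reindex[OF inj] sum_distrib_left
    unfolding sum.cartesian_product by (intro sum.cong) (auto simp: w)
qed

lemma bern_True: "finite F \<Longrightarrow> bern F p (\<lambda>E. True) = 1"
proof (induction F rule: finite_induct)
  case empty
  show ?case by (simp add: bern_def)
next
  case (insert x F)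
  have "bern ({x} \<union> F) p (\<lambda>E. True) = 1"
    using insert by (subst bern_split) (auto simp: Pow_insert)
  then show ?case by simp
qed

text \<open>Conditioning without conditional probabilities: in the split sum only the terms with
  \<open>Q E\<close> are kept, and each of them carries an inner factor of at least
  \<open>b\<close>, uniformly in \<open>E\<close>.\<close>

lemma bern_two_stage:
  assumes fin: "finite F" "finite G" and disj: "F \<inter> G = {}" and p: "0 \<le> p" "p \<le> 1"
    and a: "a \<le> bern F p Q" and b0: "0 \<le> b"
    and b: "\<And>E. E \<subseteq> F \<Longrightarrow> Q E \<Longrightarrow> b \<le> bern G p (\<lambda>E'. Q' (E \<union> E'))"
  shows "a * b \<le> bern (F \<union> G) p Q'"
proof -
  have "a * b \<le> bern F p Q * b" using a b0 by (rule mult_right_mono)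
  also have "\<dots> \<le> bern (F \<union> G) p Q'"
    unfolding bern_split[OF fin disj] unfolding bern_def[of F] sum_distrib_right
    using p b bern_nonneg[OF p] by (intro sum_mono) (auto intro!: mult_left_mono mult_nonneg_nonneg)
  finally show ?thesis .
qed

text \<open>On \<open>X \<union> Y\<close> exactly one configuration qualifies, namely
  \<open>E = X\<close>; the other edges sum out to 1.\<close>

lemma bern_cylinder:
  assumes fin: "finite F" and sub: "X \<subseteq> F" "Y \<subseteq> F" and disj: "X \<inter> Y = {}"
  shows "bern F p (\<lambda>E. X \<subseteq> E \<and> Y \<inter> E = {}) = p ^ card X * (1 - p) ^ card Y"
proof -
  have fXY: "finite X" "finite Y" using fin sub finite_subset by auto
  have F: "F = (X \<union> Y) \<union> (F - (X \<union> Y))" using sub by auto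
  have "bern F p (\<lambda>E. X \<subseteq> E \<and> Y \<inter> E = {}) =
    (\<Sum>E\<in>Pow (X \<union> Y). if E = X then p ^ card X * (1 - p) ^ card Y else 0)"
    apply (subst F, subst bern_split)
    using fXY fin apply (auto)[3]
  proof (intro sum.cong refl)
    fix E assume E: "E \<in> Pow (X \<union> Y)"
    have c: "card (X \<union> Y) - card X = card Y" using fXY disj by (simp add: card_Un_disjoint)
    have "bern (F - (X \<union> Y)) p (\<lambda>E'. X \<subseteq> E \<union> E' \<and> Y \<inter> (E \<union> E') = {}) =
       bern (F - (X \<union> Y)) p (\<lambda>E'. E = X)"
      using E disj by (intro bern_cong) blast
    also have "\<dots> = (if E = X then 1 else 0)" using fin by (simp add: bern_True) (simp add: bern_def)
    finally show "p ^ card E * (1 - p) ^ (card (X \<union> Y) - card E) *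
         bern (F - (X \<union> Y)) p (\<lambda>E'. X \<subseteq> E \<union> E' \<and> Y \<inter> (E \<union> E') = {}) =
         (if E = X then p ^ card X * (1 - p) ^ card Y else 0)" using c by simp
  qed
  also have "\<dots> = p ^ card X * (1 - p) ^ card Y" using fXY by (simp add: sum.delta)
  finally show ?thesis .
qed

lemma bern_not: "finite F \<Longrightarrow> bern F p (\<lambda>E. \<not> Q E) = 1 - bern F p Q"
proof -
  assume f: "finite F"
  have "bern F p (\<lambda>E. \<not> Q E) + bern F p Q = bern F p (\<lambda>E. True)"
    unfolding bern_def sum.distrib[symmetric] by (intro sum.cong) auto
  then show ?thesis using bern_True[OF f] by simp
qed

text \<open>The events for different \<open>v\<close> depend on disjoint edge sets, so they are
  independent. The induction splits off the edges \<open>X v \<union> Y v\<close> of one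
  \<open>v\<close> at a time.\<close>

lemma bern_no_cylinder:
  assumes "finite V" "finite F"
    and "\<And>v. v \<in> V \<Longrightarrow> X v \<subseteq> F \<and> Y v \<subseteq> F \<and> X v \<inter> Y v = {} \<and> card (X v) = x \<and> card (Y v) = y"
    and "\<And>v w. v \<in> V \<Longrightarrow> w \<in> V \<Longrightarrow> v \<noteq> w \<Longrightarrow> (X v \<union> Y v) \<inter> (X w \<union> Y w) = {}"
  shows "bern F p (\<lambda>E. \<forall>v\<in>V. \<not> (X v \<subseteq> E \<and> Y v \<inter> E = {})) = (1 - p ^ x * (1 - p) ^ y) ^ card V"
  using assms
proof (induction V arbitrary: F rule: finite_induct)
  case empty
  then show ?case by (simp add: bern_True)
next
  case (insert v V)
  define F1 F2 where "F1 = X v \<union> Y v" and "F2 = F - F1"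
  have sub: "X v \<subseteq> F" "Y v \<subseteq> F" "X v \<inter> Y v = {}" "card (X v) = x" "card (Y v) = y"
    using insert.prems(2)[of v] by auto
  have F: "F = F1 \<union> F2" and d: "F1 \<inter> F2 = {}" and fin: "finite F1" "finite F2"
    using sub insert.prems(1) finite_subset by (auto simp: F1_def F2_def)
  have oth: "X w \<inter> F1 = {} \<and> Y w \<inter> F1 = {}" if "w \<in> V" for w
    using insert.prems(3)[of w v] that insert.hyps by (auto simp: F1_def)
  have IH: "bern F2 p (\<lambda>E. \<forall>v\<in>V. \<not> (X v \<subseteq> E \<and> Y v \<inter> E = {})) = (1 - p ^ x * (1 - p) ^ y) ^ card V"
  proof (rule insert.IH)
    show "X w \<subseteq> F2 \<and> Y w \<subseteq> F2 \<and> X w \<inter> Y w = {} \<and> card (X w) = x \<and> card (Y w) = y" if "w \<in> V" for w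
      using insert.prems(2)[of w] oth[OF that] that F by auto
  qed (use fin insert.prems in auto)
  have "bern F p (\<lambda>E. \<forall>v\<in>insert v V. \<not> (X v \<subseteq> E \<and> Y v \<inter> E = {})) =
    (\<Sum>E\<in>Pow F1. p ^ card E * (1 - p) ^ (card F1 - card E) *
       (if \<not> (X v \<subseteq> E \<and> Y v \<inter> E = {}) then (1 - p ^ x * (1 - p) ^ y) ^ card V else 0))"
    unfolding F bern_split[OF fin d]
  proof (intro sum.cong refl arg_cong2[where f = "(*)"])
    fix E assume E: "E \<in> Pow F1"
    have "bern F2 p (\<lambda>E'. \<forall>v\<in>insert v V. \<not> (X v \<subseteq> E \<union> E' \<and> Y v \<inter> (E \<union> E') = {})) =
      bern F2 p (\<lambda>E'. \<not> (X v \<subseteq> E \<and> Y v \<inter> E = {}) \<and> (\<forall>v\<in>V. \<not> (X v \<subseteq> E' \<and> Y v \<inter> E' = {})))"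
    proof (intro bern_cong)
      fix E' assume E': "E' \<subseteq> F2"
      have "(X v \<subseteq> E \<union> E' \<and> Y v \<inter> (E \<union> E') = {}) \<longleftrightarrow> (X v \<subseteq> E \<and> Y v \<inter> E = {})"
        using E' d by (auto simp: F1_def)
      moreover have "(X w \<subseteq> E \<union> E' \<and> Y w \<inter> (E \<union> E') = {}) \<longleftrightarrow> (X w \<subseteq> E' \<and> Y w \<inter> E' = {})" if "w \<in> V" for w
        using E oth[OF that] by blast
      then have "(\<forall>w\<in>V. \<not> (X w \<subseteq> E \<union> E' \<and> Y w \<inter> (E \<union> E') = {})) \<longleftrightarrow>
        (\<forall>w\<in>V. \<not> (X w \<subseteq> E' \<and> Y w \<inter> E' = {}))" by blast
      ultimately show "(\<forall>v\<in>insert v V. \<not> (X v \<subseteq> E \<union> E' \<and> Y v \<inter> (E \<union> E') = {})) \<longleftrightarrow>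
        \<not> (X v \<subseteq> E \<and> Y v \<inter> E = {}) \<and> (\<forall>v\<in>V. \<not> (X v \<subseteq> E' \<and> Y v \<inter> E' = {}))" by (simp only: insert_iff ball_simps)
    qed
    also have "\<dots> = (if \<not> (X v \<subseteq> E \<and> Y v \<inter> E = {}) then (1 - p ^ x * (1 - p) ^ y) ^ card V else 0)"
      using IH by (auto simp: bern_def[of _ _ "\<lambda>_. False"])
    finally show "bern F2 p (\<lambda>E'. \<forall>v\<in>insert v V. \<not> (X v \<subseteq> E \<union> E' \<and> Y v \<inter> (E \<union> E') = {})) =
      (if \<not> (X v \<subseteq> E \<and> Y v \<inter> E = {}) then (1 - p ^ x * (1 - p) ^ y) ^ card V else 0)" .
  qed
  also have "\<dots> = bern F1 p (\<lambda>E. \<not> (X v \<subseteq> E \<and> Y v \<inter> E = {})) * (1 - p ^ x * (1 - p) ^ y) ^ card V"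
    unfolding bern_def sum_distrib_right by (intro sum.cong) auto
  also have "bern F1 p (\<lambda>E. \<not> (X v \<subseteq> E \<and> Y v \<inter> E = {})) = 1 - p ^ x * (1 - p) ^ y"
    using sub fin by (subst bern_not, simp, subst bern_cylinder) (auto simp: F1_def)
  finally show ?case using insert.hyps by simp
qed

text \<open>The second moment inequality (E Z)^2 \<le> P(Z > 0) E(Z^2) for the number Z of indices
  whose event occurs. Since all events have the same probability, a bound on the pair sum for each
  fixed index suffices; the product form avoids dividing by \<open>R\<close>.\<close>

lemma bern_second_moment:
  fixes F :: "'a set"
  assumes p: "0 \<le> p" "p \<le> 1" and fin: "finite \<Omega>" and ne: "\<Omega> \<noteq> {}" and \<pi>0: "0 < \<pi>"
    and first: "\<And>\<beta>. \<beta> \<in> \<Omega> \<Longrightarrow> bern F p (A \<beta>) = \<pi>"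
    and second: "\<And>\<beta>. \<beta> \<in> \<Omega> \<Longrightarrow>
      (\<Sum>\<beta>'\<in>\<Omega>. bern F p (\<lambda>E. A \<beta> E \<and> A \<beta>' E)) \<le> R * real (card \<Omega>) * \<pi>\<^sup>2"
  shows "1 \<le> R * bern F p (\<lambda>E. \<exists>\<beta>\<in>\<Omega>. A \<beta> E)"
proof -
  define w where "w E = p ^ card E * (1 - p) ^ (card F - card E)" for E :: "'a set"
  define Z where "Z E = (\<Sum>\<beta>\<in>\<Omega>. of_bool (A \<beta> E) :: real)" for E :: "'a set"
  define pos where "pos E = (of_bool (\<exists>\<beta>\<in>\<Omega>. A \<beta> E) :: real)" for E :: "'a set"
  have w0: "0 \<le> w E" for E :: "'a set" using p by (simp add: w_def)
  have b: "bern F p Q = (\<Sum>E\<in>Pow F. w E * of_bool (Q E))" for Q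
    unfolding bern_def w_def by (intro sum.cong) auto
  have Zp: "Z E = pos E * Z E" for E
    by (auto simp: pos_def Z_def intro!: sum.neutral)
  have m1: "(\<Sum>E\<in>Pow F. w E * Z E) = real (card \<Omega>) * \<pi>"
  proof -
    have "(\<Sum>E\<in>Pow F. w E * Z E) = (\<Sum>\<beta>\<in>\<Omega>. bern F p (A \<beta>))"
      unfolding Z_def sum_distrib_left b by (rule sum.swap)
    then show ?thesis using first by simp
  qed
  have m2: "(\<Sum>E\<in>Pow F. w E * (Z E)\<^sup>2) \<le> real (card \<Omega>) * (R * real (card \<Omega>) * \<pi>\<^sup>2)"
  proof -
    have "(\<Sum>E\<in>Pow F. w E * (Z E)\<^sup>2) =
      (\<Sum>E\<in>Pow F. \<Sum>\<beta>\<in>\<Omega>. \<Sum>\<beta>'\<in>\<Omega>. w E * of_bool (A \<beta> E \<and> A \<beta>' E))"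
      unfolding Z_def power2_eq_square sum_product of_bool_conj by (intro sum.cong refl) (simp only: sum_distrib_left)
    also have "\<dots> = (\<Sum>\<beta>\<in>\<Omega>. \<Sum>E\<in>Pow F. \<Sum>\<beta>'\<in>\<Omega>. w E * of_bool (A \<beta> E \<and> A \<beta>' E))"
      by (rule sum.swap)
    also have "\<dots> = (\<Sum>\<beta>\<in>\<Omega>. \<Sum>\<beta>'\<in>\<Omega>. bern F p (\<lambda>E. A \<beta> E \<and> A \<beta>' E))"
      unfolding b by (intro sum.cong refl sum.swap)
    also have "\<dots> \<le> (\<Sum>\<beta>\<in>\<Omega>. R * real (card \<Omega>) * \<pi>\<^sup>2)" by (intro sum_mono second)
    finally show ?thesis by simp
  qed
  \<comment> \<open>Cauchy-Schwarz needs the weight split evenly as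
    \<open>sqrt (w E) * sqrt (w E)\<close>; the indicator \<open>pos\<close> enters for free because
    \<open>Z = pos * Z\<close>.\<close>
  have "(real (card \<Omega>) * \<pi>)\<^sup>2 = (\<Sum>E\<in>Pow F. (sqrt (w E) * pos E) * (sqrt (w E) * Z E))\<^sup>2"
    unfolding m1[symmetric]
    by (intro arg_cong[where f = "\<lambda>x. x\<^sup>2"] sum.cong refl, subst Zp)
       (simp add: w0 real_sqrt_mult_self mult_ac flip: mult.assoc[of "sqrt _"])
  also have "\<dots> \<le> (\<Sum>E\<in>Pow F. (sqrt (w E) * pos E)\<^sup>2) * (\<Sum>E\<in>Pow F. (sqrt (w E) * Z E)\<^sup>2)"
    by (rule Cauchy_Schwarz_ineq_sum)
  also have "(\<Sum>E\<in>Pow F. (sqrt (w E) * pos E)\<^sup>2) = bern F p (\<lambda>E. \<exists>\<beta>\<in>\<Omega>. A \<beta> E)"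
    unfolding b by (intro sum.cong refl) (auto simp: power_mult_distrib w0 pos_def)
  also have "(\<Sum>E\<in>Pow F. (sqrt (w E) * Z E)\<^sup>2) = (\<Sum>E\<in>Pow F. w E * (Z E)\<^sup>2)"
    by (intro sum.cong refl) (auto simp: power_mult_distrib w0)
  also have "bern F p (\<lambda>E. \<exists>\<beta>\<in>\<Omega>. A \<beta> E) * \<dots> \<le>
      bern F p (\<lambda>E. \<exists>\<beta>\<in>\<Omega>. A \<beta> E) * (real (card \<Omega>) * (R * real (card \<Omega>) * \<pi>\<^sup>2))"
    by (intro mult_left_mono m2 bern_nonneg p)
  finally have "(real (card \<Omega>) * \<pi>)\<^sup>2 * 1 \<le> (real (card \<Omega>) * \<pi>)\<^sup>2 * (R * bern F p (\<lambda>E. \<exists>\<beta>\<in>\<Omega>. A \<beta> E))"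
    by (simp add: power2_eq_square mult_ac)
  moreover have "0 < (real (card \<Omega>) * \<pi>)\<^sup>2" using \<pi>0 fin ne by (simp add: card_gt_0_iff)
  ultimately show ?thesis by (simp only: mult_le_cancel_left_pos)
qed

subsection \<open>Odd cycles with pendant vertices as planar diameter graphs\<close>

text \<open>The chord bound makes the angle between \<open>b\<close> and \<open>c\<close> at most 60
  degrees, so their inner product is at least half of D^2 and the segment avoids the origin.
  Distinctness makes the inner product less than D^2, which puts the open segment strictly inside
  the ball.\<close>

lemma norm_segment_unit:
  fixes b c :: "'a::real_inner"
  assumes D: "D > 0" "norm b = D" "norm c = D" "b \<noteq> c" "norm (b - c) \<le> D" and t: "0 < t" "t < 1"
  shows "0 < norm ((1 - t) *\<^sub>R b + t *\<^sub>R c)" "norm ((1 - t) *\<^sub>R b + t *\<^sub>R c) < D"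
proof -
  have bb: "b \<bullet> b = D\<^sup>2" "c \<bullet> c = D\<^sup>2" using D by (auto simp: power2_norm_eq_inner[symmetric])
  have bc: "(norm (b - c))\<^sup>2 = 2 * D\<^sup>2 - 2 * (b \<bullet> c)"
    unfolding power2_norm_eq_inner using bb by (simp add: inner_diff_left inner_diff_right inner_commute)
  have "(norm (b - c))\<^sup>2 \<le> D\<^sup>2" using D by (intro power_mono) auto
  then have lo: "D\<^sup>2 \<le> 2 * (b \<bullet> c)" using bc by linarith
  have "0 < (norm (b - c))\<^sup>2" using D by simp
  then have hi: "b \<bullet> c < D\<^sup>2" using bc by linarith
  have n: "(norm ((1 - t) *\<^sub>R b + t *\<^sub>R c))\<^sup>2 = D\<^sup>2 - 2 * (t * (1 - t)) * (D\<^sup>2 - b \<bullet> c)"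
    unfolding power2_norm_eq_inner using bb
    by (simp add: inner_add_left inner_add_right inner_commute algebra_simps)
  have tt: "0 < t * (1 - t)" using t by simp
  then have "0 < 2 * (t * (1 - t)) * (D\<^sup>2 - b \<bullet> c)" using hi by simp
  then have "(norm ((1 - t) *\<^sub>R b + t *\<^sub>R c))\<^sup>2 < D\<^sup>2" using n by linarith
  then show "norm ((1 - t) *\<^sub>R b + t *\<^sub>R c) < D" using D by (simp add: power_less_imp_less_base)
  have "(t * (1 - t)) * (2 * (D\<^sup>2 - b \<bullet> c)) \<le> (t * (1 - t)) * D\<^sup>2"
    using tt lo by (intro mult_left_mono) auto
  also have "t * (1 - t) < 1" using t mult_strict_mono[of t 1 "1-t" 1] by simp
  then have "(t * (1 - t)) * D\<^sup>2 < 1 * D\<^sup>2" using D by (intro mult_strict_right_mono) auto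
  finally have "0 < (norm ((1 - t) *\<^sub>R b + t *\<^sub>R c))\<^sup>2" using n by (simp only: mult_ac)
  then show "0 < norm ((1 - t) *\<^sub>R b + t *\<^sub>R c)" by simp
qed

text \<open>With w at the origin, a point q of the open circular arc from b to c centred at w is a
  combination of b and c with coefficient sum greater than 1. The hypotheses on x say
  x \<bullet> x \<le> 2 (x \<bullet> b) and x \<bullet> x \<le> 2 (x \<bullet> c), hence x \<bullet> x < 2 (x \<bullet> q).\<close>

lemma arc_points:
  fixes b c w :: "'a::real_inner" and P :: "'a set"
  assumes "finite P" and D: "D > 0" "dist w b = D" "dist w c = D" "b \<noteq> c" "dist b c \<le> D"
  shows "\<exists>q. q \<notin> P \<and> dist w q = D \<and>
    (\<forall>x. x \<noteq> w \<and> dist x b \<le> D \<and> dist x c \<le> D \<longrightarrow> dist x q < D)"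
proof -
  define B C' where "B = b - w" and "C' = c - w"
  have BC: "norm B = D" "norm C' = D" "B \<noteq> C'" "norm (B - C') \<le> D"
    using D by (auto simp: B_def C'_def dist_norm norm_minus_commute)
  define u where "u t = (1 - t) *\<^sub>R B + t *\<^sub>R C'" for t :: real
  \<comment> \<open>Radial projection of the chord point \<open>u t\<close> to the circle of radius
    \<open>D\<close> about \<open>w\<close>; the scaling factor exceeds 1.\<close>
  define q where "q t = w + (D / norm (u t)) *\<^sub>R u t" for t
  note u0 = norm_segment_unit(1)[OF D(1) BC, folded u_def]
  note u1 = norm_segment_unit(2)[OF D(1) BC, folded u_def]
  \<comment> \<open>The new point has to avoid the finite set \<open>P\<close> of points already
    placed, so the arc must supply infinitely many candidates.\<close>
  have inj: "inj_on q {0<..<1}"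
  proof (rule inj_onI)
    fix s t :: real assume s: "s \<in> {0<..<1}" and t: "t \<in> {0<..<1}" and e: "q s = q t"
    define x y where "x = D / norm (u s)" and "y = D / norm (u t)"
    have xy: "x > 0" "y > 0" using u0[of s] u0[of t] s t D by (auto simp: x_def y_def)
    have "x *\<^sub>R u s = y *\<^sub>R u t" using e by (simp add: q_def x_def y_def)
    then have e2: "(x * (1 - s) - y * (1 - t)) *\<^sub>R B + (x * s - y * t) *\<^sub>R C' = 0"
      by (simp add: u_def algebra_simps)
    define X Y where "X = x * (1 - s) - y * (1 - t)" and "Y = x * s - y * t"
    have XY: "X *\<^sub>R B = (- Y) *\<^sub>R C'" using e2 by (simp add: X_def[symmetric] Y_def[symmetric] add_eq_0_iff2)
    have "\<bar>X\<bar> * D = \<bar>Y\<bar> * D" using arg_cong[OF XY, of norm] BC by simp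
    then have "\<bar>X\<bar> = \<bar>Y\<bar>" using D by simp
    then have cases: "X = Y \<or> X = - Y" by linarith
    \<comment> \<open>Otherwise \<open>X = - Y\<close> would give \<open>B = C'\<close>, and
      \<open>X = Y\<close> would give \<open>B = - C'\<close>, whose distance 2 D exceeds the
      allowed \<open>D\<close>.\<close>
    have "X = 0"
    proof (rule ccontr)
      assume X: "X \<noteq> 0"
      show False
      proof (cases "X = - Y")
        case True
        then have "X *\<^sub>R B = X *\<^sub>R C'" using XY by simp
        then show False using X BC by simp
      next
        case False
        then have "X *\<^sub>R B = X *\<^sub>R (- C')" using XY cases by simp
        then have "B = - C'" using X by (metis scaleR_cancel_left)
        then have "norm (B - C') = 2 * D" using BC(2) by (simp add: norm_minus_commute flip: scaleR_2) 
        then show False using BC D by simp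
      qed
    qed
    moreover from this have "Y = 0" using cases by simp
    ultimately have "x * (1 - s) = y * (1 - t)" "x * s = y * t" by (auto simp: X_def Y_def)
    moreover from this have "x = y" by (simp add: algebra_simps)
    ultimately show "s = t" using xy by simp
  qed
  have "infinite (q ` {0<..<1})" using finite_imageD[OF _ inj] infinite_Ioo[of "0::real" 1] by auto
  then have "\<exists>z. z \<in> q ` {0<..<1} - P" using assms(1)
    by (metis Diff_infinite_finite finite.emptyI all_not_in_conv)
  then obtain t where t: "0 < t" "t < 1" "q t \<notin> P" by auto
  have "dist w (q t) = D" using u0[OF t(1,2)] D by (simp add: q_def dist_norm)
  moreover have "dist x (q t) < D" if x: "x \<noteq> w" "dist x b \<le> D" "dist x c \<le> D" for x
  proof -
    define z where "z = x - w"
    define l where "l = D / norm (u t)"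
    have l: "l > 1" using u0[OF t(1,2)] u1[OF t(1,2)] by (simp add: l_def)
    have z: "z \<bullet> z > 0" using x by (simp add: z_def)
    have BB: "B \<bullet> B = D\<^sup>2" "C' \<bullet> C' = D\<^sup>2" using BC by (auto simp: power2_norm_eq_inner[symmetric])
    have "(norm (z - B))\<^sup>2 \<le> D\<^sup>2" using x D by (intro power_mono) (auto simp: z_def B_def dist_norm)
    then have zb: "z \<bullet> z \<le> 2 * (z \<bullet> B)" unfolding power2_norm_eq_inner using BB
      by (simp add: inner_diff_left inner_diff_right inner_commute)
    have "(norm (z - C'))\<^sup>2 \<le> D\<^sup>2" using x D by (intro power_mono) (auto simp: z_def C'_def dist_norm)
    then have zc: "z \<bullet> z \<le> 2 * (z \<bullet> C')" unfolding power2_norm_eq_inner using BB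
      by (simp add: inner_diff_left inner_diff_right inner_commute)
    have "(1 - t) * (z \<bullet> z) + t * (z \<bullet> z) \<le> (1 - t) * (2 * (z \<bullet> B)) + t * (2 * (z \<bullet> C'))"
      using zb zc t by (intro add_mono mult_left_mono) auto
    also have "\<dots> = 2 * (z \<bullet> u t)" by (simp add: u_def inner_add_right)
    finally have zu: "z \<bullet> z \<le> 2 * (z \<bullet> u t)" by (simp add: algebra_simps)
    have "z \<bullet> z < l * (z \<bullet> z)" using l z by simp
    also have "\<dots> \<le> l * (2 * (z \<bullet> u t))" using zu l by (intro mult_left_mono) auto
    finally have lt: "z \<bullet> z < 2 * (z \<bullet> (l *\<^sub>R u t))" by simp
    have nl: "norm (l *\<^sub>R u t) = D" using u0[OF t(1,2)] D by (simp add: l_def)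
    then have "(l *\<^sub>R u t) \<bullet> (l *\<^sub>R u t) = D\<^sup>2" by (metis power2_norm_eq_inner)
    then have "(norm (z - l *\<^sub>R u t))\<^sup>2 < D\<^sup>2" unfolding power2_norm_eq_inner using lt
      by (simp only: inner_diff_left inner_diff_right) (simp add: inner_commute)
    then have "norm (z - l *\<^sub>R u t) < D" using D by (simp add: power_less_imp_less_base)
    moreover have "x - q t = z - l *\<^sub>R u t" by (simp add: z_def q_def l_def)
    ultimately show ?thesis by (simp add: dist_norm)
  qed
  ultimately show ?thesis using t by blast
qed

text \<open>The distance \<open>D\<close> is a parameter, not the diameter of the image: points can
  then be added one at a time at a fixed \<open>D\<close>. As soon as there is one edge,
  \<open>D\<close> is the diameter.\<close>

definition diam_embedding :: "(nat \<Rightarrow> 'a::real_inner) \<Rightarrow> nat set \<Rightarrow> nat set set \<Rightarrow> real \<Rightarrow> bool" where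
  "diam_embedding f W F D \<longleftrightarrow> inj_on f W \<and>
     (\<forall>x\<in>W. \<forall>y\<in>W. x \<noteq> y \<longrightarrow> dist (f x) (f y) \<le> D \<and> ({x, y} \<in> F \<longleftrightarrow> dist (f x) (f y) = D))"

lemma diam_embedding_imp_diameter_graph:
  fixes f :: "nat \<Rightarrow> 'a::euclidean_space"
  assumes emb: "diam_embedding f W F D" and fin: "finite W" and D: "D > 0"
    and e: "x0 \<in> W" "y0 \<in> W" "x0 \<noteq> y0" "{x0, y0} \<in> F"
  shows "is_diameter_graph TYPE('a) W F"
proof -
  have le: "dist (f x) (f y) \<le> D" if "x \<in> W" "y \<in> W" for x y
    using emb that D by (cases "x = y") (auto simp: diam_embedding_def)
  have "dist (f x0) (f y0) = D" using emb e by (auto simp: diam_embedding_def)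
  then have "D \<le> diameter (f ` W)"
    using diameter_bounded_bound[of "f ` W" "f x0" "f y0"] fin e finite_imp_bounded by auto
  moreover have "diameter (f ` W) \<le> D" using le e by (intro diameter_le) (auto simp: dist_norm)
  ultimately have "diameter (f ` W) = D" by simp
  then show ?thesis using emb fin unfolding is_diameter_graph_def diam_embedding_def by auto
qed

text \<open>The new vertex goes on the arc centred at \<open>f w\<close> between the images of two
  neighbours \<open>b\<close>, \<open>c\<close> of \<open>w\<close>. Every old point is within
  \<open>D\<close> of both ends of this arc, so all of them except \<open>f w\<close> are strictly
  closer than \<open>D\<close> to the new point.\<close>

lemma diam_embedding_add_pendant:
  fixes f :: "nat \<Rightarrow> 'a::real_inner"
  assumes emb: "diam_embedding f W F D" and fin: "finite W" and D: "D > 0"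
    and v: "v \<notin> W" and w: "w \<in> W" and nb: "\<And>x. x \<in> W \<Longrightarrow> {v, x} \<in> F \<longleftrightarrow> x = w"
    and bc: "b \<in> W" "c \<in> W" "b \<noteq> c" "b \<noteq> w" "c \<noteq> w" "{w, b} \<in> F" "{w, c} \<in> F"
  shows "\<exists>g :: nat \<Rightarrow> 'a. diam_embedding g (insert v W) F D"
proof -
  have le: "dist (f x) (f y) \<le> D" if "x \<in> W" "y \<in> W" for x y
    using emb that D by (cases "x = y") (auto simp: diam_embedding_def)
  have injf: "f x = f y \<longleftrightarrow> x = y" if "x \<in> W" "y \<in> W" for x y
    using emb that by (auto simp: diam_embedding_def inj_on_def)
  have iff: "{x, y} \<in> F \<longleftrightarrow> dist (f x) (f y) = D" if "x \<in> W" "y \<in> W" "x \<noteq> y" for x y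
    using emb that by (auto simp: diam_embedding_def)
  obtain q where q: "q \<notin> f ` W" "dist (f w) q = D"
    "\<And>x. x \<noteq> f w \<Longrightarrow> dist x (f b) \<le> D \<Longrightarrow> dist x (f c) \<le> D \<Longrightarrow> dist x q < D"
    using arc_points[of "f ` W" D "f w" "f b" "f c"] fin D iff[of w b] iff[of w c] bc w le injf[of b c] by blast
  have new: "dist (f x) q \<le> D \<and> ({v, x} \<in> F \<longleftrightarrow> dist (f x) q = D)" if "x \<in> W" for x
  proof (cases "x = w")
    case True
    then show ?thesis using q nb that by auto
  next
    case False
    then have "dist (f x) q < D" using that injf w le bc by (intro q(3)) auto
    then show ?thesis using False nb that by auto
  qed
  have "diam_embedding (f(v := q)) (insert v W) F D"
    unfolding diam_embedding_def
  proof (intro conjI ballI impI)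
    show "inj_on (f(v := q)) (insert v W)"
      using q(1) v injf by (auto simp: inj_on_def)
  next
    fix x y assume xy: "x \<in> insert v W" "y \<in> insert v W" "x \<noteq> y"
    show "dist ((f(v := q)) x) ((f(v := q)) y) \<le> D"
      using xy new le v by (auto simp: dist_commute)
    show "({x, y} \<in> F) = (dist ((f(v := q)) x) ((f(v := q)) y) = D)"
      using xy new[of x] new[of y] iff v by (auto simp: dist_commute insert_commute)
  qed
  then show ?thesis by blast
qed

text \<open>The two neighbours that span the arc are taken from the core \<open>K\<close>, so they
  stay available however many pendants were placed before. Independence of \<open>I\<close> ensures
  that each new vertex has one neighbour among all earlier ones.\<close>

lemma diam_embedding_add_pendants:
  fixes f :: "nat \<Rightarrow> 'a::real_inner"
  assumes "finite I" and emb: "diam_embedding f K F D" and fin: "finite K" and D: "D > 0"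
    and "I \<inter> K = {}"
    and "\<And>v. v \<in> I \<Longrightarrow> a v \<in> K"
    and "\<And>v x. v \<in> I \<Longrightarrow> x \<in> K \<Longrightarrow> {v, x} \<in> F \<longleftrightarrow> x = a v"
    and "\<And>u v. u \<in> I \<Longrightarrow> v \<in> I \<Longrightarrow> u \<noteq> v \<Longrightarrow> {u, v} \<notin> F"
    and two: "\<And>w. w \<in> K \<Longrightarrow> \<exists>b\<in>K. \<exists>c\<in>K. b \<noteq> c \<and> b \<noteq> w \<and> c \<noteq> w \<and> {w, b} \<in> F \<and> {w, c} \<in> F"
  shows "\<exists>g :: nat \<Rightarrow> 'a. diam_embedding g (K \<union> I) F D"
  using assms(1,5-8)
proof (induction I rule: finite_induct)
  case empty
  then show ?case using emb by auto
next
  case (insert v I)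
  obtain g :: "nat \<Rightarrow> 'a" where g: "diam_embedding g (K \<union> I) F D"
    using insert.IH insert.prems by auto
  have aK: "a v \<in> K" using insert.prems by auto
  obtain b c where bc: "b \<in> K" "c \<in> K" "b \<noteq> c" "b \<noteq> a v" "c \<noteq> a v" "{a v, b} \<in> F" "{a v, c} \<in> F"
    using two[OF aK] by blast
  have nb: "{v, x} \<in> F \<longleftrightarrow> x = a v" if x: "x \<in> K \<union> I" for x
  proof (cases "x \<in> K")
    case True then show ?thesis using insert.prems(3)[of v x] by simp
  next
    case False
    then have "x \<in> I" "x \<noteq> a v" using x aK by auto
    then show ?thesis using insert.prems(4)[of v x] insert.hyps by auto
  qed
  have "\<exists>h :: nat \<Rightarrow> 'a. diam_embedding h (insert v (K \<union> I)) F D"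
    by (rule diam_embedding_add_pendant[OF g, where w = "a v" and b = b and c = c])
       (use fin insert D bc aK nb in auto)
  then show ?case by simp
qed

section \<open>Odd cycles as regular star polygons\<close>

lemma dist_circle_points:
  "dist (vector [cos a, sin a] :: real^2) (vector [cos b, sin b]) = 2 * \<bar>sin ((a - b) / 2)\<bar>"
proof -
  have "(dist (vector [cos a, sin a] :: real^2) (vector [cos b, sin b]))\<^sup>2 = (cos a - cos b)\<^sup>2 + (sin a - sin b)\<^sup>2"
    by (simp add: dist_norm norm_vec_def L2_set_def UNIV_2)
  also have "\<dots> = ((cos a)\<^sup>2 + (sin a)\<^sup>2) + ((cos b)\<^sup>2 + (sin b)\<^sup>2) - 2 * (cos a * cos b + sin a * sin b)"
    by (simp add: power2_eq_square algebra_simps)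
  also have "\<dots> = 2 - 2 * cos (a - b)" by (simp add: cos_diff)
  also have "cos (a - b) = 1 - 2 * (sin ((a - b) / 2))\<^sup>2"
    using cos_double_sin[of "(a - b) / 2"] by (simp only: nonzero_mult_div_cancel_left times_divide_eq_right)
  finally have "(dist (vector [cos a, sin a] :: real^2) (vector [cos b, sin b]))\<^sup>2 = (2 * \<bar>sin ((a - b) / 2)\<bar>)\<^sup>2"
    by (simp add: power_mult_distrib)
  then show ?thesis by (subst (asm) power2_eq_iff_nonneg) auto
qed

definition cyc_adj :: "nat \<Rightarrow> nat \<Rightarrow> nat \<Rightarrow> bool" where
  "cyc_adj m i j \<longleftrightarrow> j = Suc i \<or> i = Suc j \<or> (i = 0 \<and> Suc j = m) \<or> (j = 0 \<and> Suc i = m)"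

text \<open>Vertex j of the star polygon sits at angle j (pi + pi / m). For vertices whose indices
  differ by d, let e be the odd one of d and m - d; the chord has length 2 cos (e pi / (2 m)),
  which is maximal exactly for e = 1.\<close>

lemma star_polygon_chord:
  fixes m i j :: nat
  assumes m: "odd m" "m \<ge> 3" and ij: "i < j" "j < m"
  defines "s \<equiv> 2 * \<bar>sin ((real i * (pi + pi / real m) - real j * (pi + pi / real m)) / 2)\<bar>"
  shows "0 < s" "s \<le> 2 * cos (pi / (2 * real m))"
    "cyc_adj m i j \<longleftrightarrow> s = 2 * cos (pi / (2 * real m))"
proof -
  define d where "d = j - i"
  have d: "0 < d" "d < m" using ij by (auto simp: d_def)
  define e where "e = (if odd d then d else m - d)"
  have e: "1 \<le> e" "e < m" using d by (auto simp: e_def)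
  have rd: "real j = real i + real d" using ij by (simp add: d_def)
  have m0: "real m > 0" using m by simp
  have sn: "s = 2 * \<bar>sin (real d * (pi / 2) + real d * (pi / (2 * real m)))\<bar>"
  proof -
    have "(real i * (pi + pi / real m) - real j * (pi + pi / real m)) / 2 =
      - (real d * (pi / 2) + real d * (pi / (2 * real m)))"
      unfolding rd using m0 by (simp add: field_simps)
    then show ?thesis unfolding s_def by (simp only: sin_minus abs_minus)
  qed
  \<comment> \<open>A shift by a multiple of pi only changes a sign. The remaining angle has an
    extra pi / 2 for odd \<open>d\<close>; for even \<open>d\<close> it is the complement of the
    angle belonging to \<open>m - d\<close>.\<close>
  have cs: "s = 2 * \<bar>cos (real e * (pi / (2 * real m)))\<bar>"
  proof (cases "odd d")
    case True
    then obtain k where k: "d = 2 * k + 1" by (elim oddE)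
    have "real d * (pi / 2) + real d * (pi / (2 * real m)) = (real d * (pi / (2 * real m)) + pi/2) + real k * pi"
      by (simp add: k algebra_simps)
    then have "\<bar>sin (real d * (pi / 2) + real d * (pi / (2 * real m)))\<bar> = \<bar>sin (real d * (pi / (2 * real m)) + pi/2)\<bar>"
      by (simp only: sin_add[of _ "real k * pi"]) (simp add: abs_mult)
    also have "\<dots> = \<bar>cos (real d * (pi / (2 * real m)))\<bar>" by (simp add: sin_add)
    finally show ?thesis unfolding sn e_def using True by simp
  next
    case False
    then obtain k where k: "d = 2 * k" by auto
    have "real d * (pi / 2) + real d * (pi / (2 * real m)) = real d * (pi / (2 * real m)) + real k * pi"
      by (simp add: k)
    then have "\<bar>sin (real d * (pi / 2) + real d * (pi / (2 * real m)))\<bar> = \<bar>sin (real d * (pi / (2 * real m)))\<bar>"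
      by (simp only: sin_add[of _ "real k * pi"]) (simp add: abs_mult)
    also have "\<dots> = \<bar>sin (pi / 2 - real e * (pi / (2 * real m)))\<bar>"
      using False d m0 by (intro arg_cong[where f = "\<lambda>x. \<bar>sin x\<bar>"]) (simp add: e_def of_nat_diff field_simps)
    finally show ?thesis unfolding sn by (simp add: sin_diff)
  qed
  have ang: "0 \<le> real e' * (pi / (2 * real m))" "real e' * (pi / (2 * real m)) < pi / 2" if "e' < m" for e'
  proof -
    show "0 \<le> real e' * (pi / (2 * real m))" by simp
    have "real e' * (pi / (2 * real m)) < real m * (pi / (2 * real m))"
      using that m0 by (intro mult_strict_right_mono) auto
    also have "\<dots> = pi / 2" using m0 by simp
    finally show "real e' * (pi / (2 * real m)) < pi / 2" .
  qed
  have cpos: "cos (real e * (pi / (2 * real m))) > 0"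
    using ang[OF e(2)] pi_gt_zero by (intro cos_gt_zero_pi) linarith+
  then have cs': "s = 2 * cos (real e * (pi / (2 * real m)))" using cs by simp
  show "0 < s" using cs' cpos by simp
  \<comment> \<open>\<open>d = 1\<close> gives the path edges, \<open>m - d = 1\<close> the edge
    between 0 and \<open>m - 1\<close>, where \<open>d\<close> is even because \<open>m\<close> is
    odd.\<close>
  have adj: "cyc_adj m i j \<longleftrightarrow> e = 1"
    using ij m by (auto simp: cyc_adj_def e_def d_def)
  have lt: "s < 2 * cos (pi / (2 * real m))" if "e \<noteq> 1"
  proof -
    have "cos (real e * (pi / (2 * real m))) < cos (real 1 * (pi / (2 * real m)))"
    proof (rule cos_monotone_0_pi)
      show "real 1 * (pi / (2 * real m)) < real e * (pi / (2 * real m))"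
        using that e m0 by (intro mult_strict_right_mono) auto
      show "real e * (pi / (2 * real m)) \<le> pi" using ang[OF e(2)] pi_gt_zero by linarith
    qed (use m0 in simp)
    then show ?thesis unfolding cs' by simp
  qed
  show "s \<le> 2 * cos (pi / (2 * real m))" using lt cs' by (cases "e = 1") auto
  show "cyc_adj m i j \<longleftrightarrow> s = 2 * cos (pi / (2 * real m))"
    unfolding adj using lt cs' by (cases "e = 1") auto
qed

lemma odd_cycle_diam_embedding:
  assumes m: "odd m" "m \<ge> 3" and inj: "inj_on c {..<m}"
    and F: "\<And>i j. i < j \<Longrightarrow> j < m \<Longrightarrow> {c i, c j} \<in> F \<longleftrightarrow> cyc_adj m i j"
  shows "\<exists>f :: nat \<Rightarrow> real^2. \<exists>D>0. diam_embedding f (c ` {..<m}) F D"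
proof -
  define g where "g j = (vector [cos (real j * (pi + pi / real m)), sin (real j * (pi + pi / real m))] :: real^2)" for j :: nat
  define D where "D = 2 * cos (pi / (2 * real m))"
  define f where "f x = g (inv_into {..<m} c x)" for x
  have fc: "f (c i) = g i" if "i < m" for i using inj that by (simp add: f_def)
  have key: "0 < dist (g i) (g j) \<and> dist (g i) (g j) \<le> D \<and> ({c i, c j} \<in> F \<longleftrightarrow> dist (g i) (g j) = D)"
    if "i < j" "j < m" for i j
    using star_polygon_chord[OF m that] F[OF that] unfolding g_def dist_circle_points D_def by auto
  have key2: "0 < dist (g i) (g j) \<and> dist (g i) (g j) \<le> D \<and> ({c i, c j} \<in> F \<longleftrightarrow> dist (g i) (g j) = D)"
    if "i < m" "j < m" "i \<noteq> j" for i j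
    using key[of i j] key[of j i] that by (cases "i < j") (auto simp: dist_commute insert_commute)
  have "D > 0" using key[of 0 1] m by linarith
  moreover have "diam_embedding f (c ` {..<m}) F D"
    unfolding diam_embedding_def
  proof (intro conjI ballI impI)
    show "inj_on f (c ` {..<m})"
    proof (rule inj_onI)
      fix x y assume "x \<in> c ` {..<m}" "y \<in> c ` {..<m}" "f x = f y"
      then obtain i j where ij: "i < m" "j < m" "x = c i" "y = c j" "g i = g j" using fc by auto
      then have "i = j" using key2[of i j] by (cases "i = j") auto
      then show "x = y" using ij by simp
    qed
  next
    fix x y assume "x \<in> c ` {..<m}" "y \<in> c ` {..<m}" "x \<noteq> y"
    then obtain i j where ij: "i < m" "j < m" "x = c i" "y = c j" "i \<noteq> j" by auto
    show "dist (f x) (f y) \<le> D" "({x, y} \<in> F) = (dist (f x) (f y) = D)"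
      using key2[OF ij(1,2,5)] fc ij by auto
  qed
  ultimately show ?thesis by blast
qed

section \<open>Chromatic number and connectivity of the cycle with pendants\<close>

lemma odd_cycle_not_2_colorable:
  fixes col :: "nat \<Rightarrow> nat"
  assumes m: "odd m" "m \<ge> 3" and c2: "\<And>j. j < m \<Longrightarrow> col j < 2"
    and proper: "\<And>i j. i < j \<Longrightarrow> j < m \<Longrightarrow> cyc_adj m i j \<Longrightarrow> col i \<noteq> col j"
  shows False
proof -
  \<comment> \<open>Two colours must alternate along the path, so the even index
    \<open>m - 1\<close> repeats the colour of its neighbour 0.\<close>
  have alt: "j < m \<Longrightarrow> (col j = col 0) = even j" for j
  proof (induction j)
    case (Suc j)
    have "col j \<noteq> col (Suc j)" using proper[of j "Suc j"] Suc.prems by (simp add: cyc_adj_def)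
    then show ?case using Suc c2[of j] c2[of "Suc j"] c2[of 0] by (auto simp: less_2_cases_iff)
  qed simp
  have "col (m - 1) = col 0" using alt[of "m - 1"] m by simp
  then show False using proper[of 0 "m - 1"] m by (auto simp: cyc_adj_def)
qed

lemma odd_cycle_pendants:
  assumes m: "odd m" "m \<ge> 3" and inj: "inj_on c {..<m}"
    and cyc: "\<And>i j. i < j \<Longrightarrow> j < m \<Longrightarrow> {c i, c j} \<in> F \<longleftrightarrow> cyc_adj m i j"
    and finI: "finite I" and IK: "I \<inter> c ` {..<m} = {}"
    and a: "\<And>v. v \<in> I \<Longrightarrow> a v < m"
    and att: "\<And>v j. v \<in> I \<Longrightarrow> j < m \<Longrightarrow> {v, c j} \<in> F \<longleftrightarrow> j = a v"
    and ind: "\<And>u v. u \<in> I \<Longrightarrow> v \<in> I \<Longrightarrow> u \<noteq> v \<Longrightarrow> {u, v} \<notin> F"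
  shows "is_diameter_graph TYPE(real^2) (c ` {..<m} \<union> I) F"
    "chromatic_number (c ` {..<m} \<union> I) F = 3"
    "graph_connected (c ` {..<m} \<union> I) F"
proof -
  let ?K = "c ` {..<m}" and ?W = "c ` {..<m} \<union> I"
  have cinj: "c i = c j \<longleftrightarrow> i = j" if "i < m" "j < m" for i j
    using inj that by (auto simp: inj_on_def)
  have cyc': "{c i, c j} \<in> F \<longleftrightarrow> cyc_adj m i j" if "i < m" "j < m" "i \<noteq> j" for i j
    using cyc[of i j] cyc[of j i] that
    by (cases "i < j") (auto simp: insert_commute cyc_adj_def)
  obtain f :: "nat \<Rightarrow> real^2" and D where f: "D > 0" "diam_embedding f ?K F D"
    using odd_cycle_diam_embedding[OF m inj cyc] by blast
  have two: "\<exists>b\<in>?K. \<exists>d\<in>?K. b \<noteq> d \<and> b \<noteq> w \<and> d \<noteq> w \<and> {w, b} \<in> F \<and> {w, d} \<in> F" if "w \<in> ?K" for w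
  proof -
    from that obtain i where i: "i < m" "w = c i" by auto
    \<comment> \<open>Successor and predecessor of \<open>i\<close> on the cycle;
      \<open>m \<ge> 3\<close> keeps them distinct. They span the arc that carries the pendants at
      \<open>c i\<close>.\<close>
    define s t where "s = (if Suc i = m then 0 else Suc i)" and "t = (if i = 0 then m - 1 else i - 1)"
    have st: "s < m" "t < m" "s \<noteq> t" "s \<noteq> i" "t \<noteq> i" "cyc_adj m i s" "cyc_adj m i t"
      using i m by (auto simp: s_def t_def cyc_adj_def split: if_splits)
    show ?thesis
      using st i cyc'[of i s] cyc'[of i t] cinj
      by (intro bexI[of _ "c s"] bexI[of _ "c t"]) auto
  qed
  obtain g :: "nat \<Rightarrow> real^2" where g: "diam_embedding g ?W F D"
    using diam_embedding_add_pendants[OF finI f(2) _ f(1) IK, of "\<lambda>v. c (a v)"] a att ind two cinj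
    by force
  have e01: "{c 0, c 1} \<in> F" using cyc[of 0 1] m by (simp add: cyc_adj_def)
  show "is_diameter_graph TYPE(real^2) ?W F"
    by (rule diam_embedding_imp_diameter_graph[OF g _ f(1), of "c 0" "c 1"])
       (use finI m e01 cinj[of 0 1] in auto)
  show "chromatic_number ?W F = 3"
    unfolding chromatic_number_def
  proof (rule Least_equality)
    \<comment> \<open>Parity along the path, with the third colour spent on the last vertex. A
      pendant takes 0 or 1, whichever its only neighbour leaves free.\<close>
    define kc where "kc j = (if Suc j = m then 2 else j mod 2)" for j :: nat
    define col where "col x = (if x \<in> I then (if kc (a x) = 0 then 1 else 0) else kc (inv_into {..<m} c x))" for x
    have colc: "col (c j) = kc j" if "j < m" for j
      using that IK inj by (auto simp: col_def)
    have kc: "kc i \<noteq> kc j" if "i < m" "j < m" "cyc_adj m i j" for i j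
      using that m by (auto simp: kc_def cyc_adj_def mod_Suc split: if_splits)
    have kc3: "kc j < 3" for j unfolding kc_def by presburger
    have proper: "col x \<noteq> col y" if xy: "x \<in> ?W" "y \<in> ?W" "{x, y} \<in> F" "x \<noteq> y" for x y
    proof -
      have pend: "col v \<noteq> col (c j)" if "v \<in> I" "j < m" "{v, c j} \<in> F" for v j
        using att[OF that(1,2)] that colc[OF that(2)] by (auto simp: col_def)
      consider i j where "x = c i" "y = c j" "i < m" "j < m" | j where "x \<in> I" "y = c j" "j < m"
        | j where "y \<in> I" "x = c j" "j < m" | "x \<in> I" "y \<in> I" using xy(1,2) by blast
      then show ?thesis
      proof cases
        case 1
        then show ?thesis using xy cyc'[of i j] kc[of i j] colc by auto
      next
        case 2
        then show ?thesis using pend xy by auto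
      next
        case 3
        then show ?thesis using pend[of y j] xy by (auto simp: insert_commute)
      next
        case 4
        then show ?thesis using ind xy by auto
      qed
    qed
    show "\<exists>col :: nat \<Rightarrow> nat. (\<forall>x\<in>?W. col x < 3) \<and> (\<forall>x\<in>?W. \<forall>y\<in>?W. {x, y} \<in> F \<and> x \<noteq> y \<longrightarrow> col x \<noteq> col y)"
    proof (intro exI[of _ col] conjI ballI impI)
      show "col x < 3" for x using kc3 by (simp add: col_def)
    qed (use proper in blast)
  next
    fix k assume "\<exists>col :: nat \<Rightarrow> nat. (\<forall>x\<in>?W. col x < k) \<and> (\<forall>x\<in>?W. \<forall>y\<in>?W. {x, y} \<in> F \<and> x \<noteq> y \<longrightarrow> col x \<noteq> col y)"
    then obtain col :: "nat \<Rightarrow> nat" where col1: "\<forall>x\<in>?W. col x < k"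
      and col2: "\<forall>x\<in>?W. \<forall>y\<in>?W. {x, y} \<in> F \<and> x \<noteq> y \<longrightarrow> col x \<noteq> col y"
      by (elim exE conjE)
    show "3 \<le> k"
    proof (rule ccontr)
      assume "\<not> 3 \<le> k"
      then have k: "k \<le> 2" by simp
      show False
      proof (rule odd_cycle_not_2_colorable[OF m, of "\<lambda>j. col (c j)"])
        show "col (c j) < 2" if "j < m" for j using bspec[OF col1, of "c j"] that k by auto
        show "col (c i) \<noteq> col (c j)" if "i < j" "j < m" "cyc_adj m i j" for i j
          using bspec[OF bspec[OF col2, of "c i"], of "c j"] cyc[OF that(1,2)] that cinj[of i j] by auto
      qed
    qed
  qed
  define adj where "adj = (\<lambda>x y. x \<in> ?W \<and> y \<in> ?W \<and> {x, y} \<in> F)"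
  have r0: "j < m \<Longrightarrow> adj\<^sup>*\<^sup>* (c 0) (c j)" for j
  proof (induction j)
    case (Suc j)
    have "{c j, c (Suc j)} \<in> F" using cyc[of j "Suc j"] Suc.prems by (simp add: cyc_adj_def)
    then have "adj (c j) (c (Suc j))" using Suc.prems by (auto simp: adj_def)
    then show ?case using Suc by auto
  qed simp
  have r1: "adj\<^sup>*\<^sup>* (c 0) x" if "x \<in> ?W" for x
  proof (cases "x \<in> I")
    case True
    have "adj (c (a x)) x" using att[OF True a[OF True]] a[OF True] True by (auto simp: adj_def insert_commute)
    then show ?thesis using r0[OF a[OF True]] by auto
  next
    case False
    then show ?thesis using that r0 by auto
  qed
  have "symp adj" by (auto intro!: sympI simp: adj_def insert_commute)
  then have "symp adj\<^sup>*\<^sup>*" by (rule symp_rtranclp)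
  then have "adj\<^sup>*\<^sup>* x y" if "x \<in> ?W" "y \<in> ?W" for x y
    using r1[OF that(1)] r1[OF that(2)] by (meson sympD rtranclp_trans)
  then show "graph_connected ?W F" unfolding graph_connected_def adj_def by blast
qed

subsection \<open>Exposing an induced odd cycle\<close>

lemma finite_all_edges: "finite (all_edges n)"
  by (rule finite_subset[of _ "Pow {..<n}"]) (auto simp: all_edges_def)

lemma all_edges_mono: "N \<le> N' \<Longrightarrow> all_edges N \<subseteq> all_edges N'"
  by (fastforce simp: all_edges_def)

lemma doubleton_in_all_edges_iff: "{x, y} \<in> all_edges n \<longleftrightarrow> x < n \<and> y < n \<and> x \<noteq> y"
  by (auto simp: all_edges_def doubleton_eq_iff)

text \<open>Passing from \<open>N\<close> to \<open>N'\<close> vertices reveals exactly the edges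
  with an endpoint in \<open>{N..<N'}\<close>, so the graph on the first \<open>N\<close> vertices
  carries no information about them.\<close>

lemma prob_G_extend:
  assumes N: "N \<le> N'" and p: "0 \<le> p" "p \<le> 1"
    and a: "a \<le> prob_G N p Q" and b0: "0 \<le> b"
    and b: "\<And>E. E \<subseteq> all_edges N \<Longrightarrow> Q E \<Longrightarrow>
      b \<le> bern (all_edges N' - all_edges N) p (\<lambda>E'. Q' (E \<union> E'))"
  shows "a * b \<le> prob_G N' p Q'"
proof -
  have "a * b \<le> bern (all_edges N \<union> (all_edges N' - all_edges N)) p Q'"
    by (rule bern_two_stage[OF _ _ _ p a[unfolded prob_G_eq_bern] b0 b]) (auto simp: finite_all_edges)
  then show ?thesis using all_edges_mono[OF N] by (simp add: prob_G_eq_bern Un_absorb1)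
qed

text \<open>The edge sets from distinct new vertices to the image of \<open>c\<close> are disjoint,
  which makes the \<open>N' - N\<close> vertices independent trials. Each has the prescribed
  neighbourhood \<open>T\<close> with probability p^|T| (1 - p)^(i - |T|).\<close>

lemma vertex_extension_prob:
  fixes c :: "nat \<Rightarrow> nat"
  assumes p: "0 \<le> p" "p \<le> 1" and inj: "inj_on c {..<i}" and c: "\<And>j. j < i \<Longrightarrow> c j < N"
    and T: "T \<subseteq> {..<i}" and N: "N \<le> N'"
  shows "1 - (1 - p ^ card T * (1 - p) ^ (i - card T)) ^ (N' - N) \<le>
    bern (all_edges N' - all_edges N) p (\<lambda>E. \<exists>v\<in>{N..<N'}. \<forall>j<i. {c j, v} \<in> E \<longleftrightarrow> j \<in> T)"
proof -
  let ?F = "all_edges N' - all_edges N"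
  define X where "X v = (\<lambda>j. {c j, v}) ` T" for v
  define Y where "Y v = (\<lambda>j. {c j, v}) ` ({..<i} - T)" for v
  have inj2: "inj_on (\<lambda>j. {c j, v}) {..<i}" if "v \<ge> N" for v
  proof (rule inj_onI)
    fix x y assume xy: "x \<in> {..<i}" "y \<in> {..<i}" "{c x, v} = {c y, v}"
    then have "c x = c y" by (auto simp: doubleton_eq_iff)
    then show "x = y" using inj xy by (auto simp: inj_on_def)
  qed
  have finT: "finite T" using T finite_subset by blast
  have cT: "card ({..<i} - T) = i - card T" using T finT by (simp add: card_Diff_subset)
  have sub: "(\<lambda>j. {c j, v}) ` {..<i} \<subseteq> ?F" if v: "v \<in> {N..<N'}" for v
  proof
    fix e assume "e \<in> (\<lambda>j. {c j, v}) ` {..<i}"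
    then obtain j where j: "j < i" "e = {c j, v}" by auto
    then show "e \<in> ?F" using c[of j] v by (auto simp: doubleton_in_all_edges_iff)
  qed
  have "bern ?F p (\<lambda>E. \<forall>v\<in>{N..<N'}. \<not> (X v \<subseteq> E \<and> Y v \<inter> E = {})) =
    (1 - p ^ card T * (1 - p) ^ (i - card T)) ^ card {N..<N'}"
  proof (rule bern_no_cylinder)
    fix v assume v: "v \<in> {N..<N'}"
    then have iv: "inj_on (\<lambda>j. {c j, v}) {..<i}" by (intro inj2) simp
    have "X v \<subseteq> (\<lambda>j. {c j, v}) ` {..<i}" "Y v \<subseteq> (\<lambda>j. {c j, v}) ` {..<i}" using T by (auto simp: X_def Y_def)
    then have "X v \<subseteq> ?F" "Y v \<subseteq> ?F" using sub[OF v] by blast+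
    moreover have "X v \<inter> Y v = {}" unfolding X_def Y_def
      by (subst inj_on_image_Int[OF iv, symmetric]) (use T in auto)
    moreover have "card (X v) = card T" unfolding X_def
      by (rule card_image[OF inj_on_subset[OF iv T]])
    moreover have "card (Y v) = i - card T" unfolding Y_def cT[symmetric]
      by (rule card_image[OF inj_on_subset[OF iv]]) auto
    ultimately show "X v \<subseteq> ?F \<and> Y v \<subseteq> ?F \<and> X v \<inter> Y v = {} \<and> card (X v) = card T \<and> card (Y v) = i - card T"
      by blast
  next
    fix v w assume vw: "v \<in> {N..<N'}" "w \<in> {N..<N'}" "v \<noteq> w"
    have "{c j, v} \<noteq> {c j', w}" if "j < i" "j' < i" for j j'
      using c[OF that(1)] c[OF that(2)] vw by (auto simp: doubleton_eq_iff)
    moreover have "X u \<union> Y u = (\<lambda>j. {c j, u}) ` {..<i}" for u using T by (auto simp: X_def Y_def)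
    ultimately show "(X v \<union> Y v) \<inter> (X w \<union> Y w) = {}" by auto
  qed (auto simp: finite_all_edges)
  then have "1 - (1 - p ^ card T * (1 - p) ^ (i - card T)) ^ (N' - N) =
    bern ?F p (\<lambda>E. \<not> (\<forall>v\<in>{N..<N'}. \<not> (X v \<subseteq> E \<and> Y v \<inter> E = {})))"
    by (subst bern_not) (auto simp: finite_all_edges)
  also have "\<dots> \<le> bern ?F p (\<lambda>E. \<exists>v\<in>{N..<N'}. \<forall>j<i. {c j, v} \<in> E \<longleftrightarrow> j \<in> T)"
  proof (rule bern_mono[OF p])
    fix E assume "\<not> (\<forall>v\<in>{N..<N'}. \<not> (X v \<subseteq> E \<and> Y v \<inter> E = {}))"
    then obtain v where v: "v \<in> {N..<N'}" "X v \<subseteq> E" "Y v \<inter> E = {}" by blast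
    have "{c j, v} \<in> E \<longleftrightarrow> j \<in> T" if "j < i" for j
    proof (cases "j \<in> T")
      case True then show ?thesis using v by (auto simp: X_def)
    next
      case False
      then have "{c j, v} \<in> Y v" using that by (auto simp: Y_def)
      then show ?thesis using v False by blast
    qed
    then show "\<exists>v\<in>{N..<N'}. \<forall>j<i. {c j, v} \<in> E \<longleftrightarrow> j \<in> T" using v by blast
  qed
  finally show ?thesis .
qed

text \<open>The pattern \<open>adj\<close> is read only for \<open>i < j\<close>, so the path may be
  given by the asymmetric relation \<open>j' = Suc j\<close>.\<close>

definition has_induced :: "(nat \<Rightarrow> nat \<Rightarrow> bool) \<Rightarrow> nat \<Rightarrow> nat \<Rightarrow> nat set set \<Rightarrow> bool" where
  "has_induced adj m N E \<longleftrightarrow> (\<exists>c. inj_on c {..<m} \<and> (\<forall>j<m. c j < N) \<and>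
     (\<forall>i j. i < j \<longrightarrow> j < m \<longrightarrow> ({c i, c j} \<in> E \<longleftrightarrow> adj i j)))"

text \<open>One statement for both kinds of extension: \<open>T\<close> is a single endpoint when
  the path grows and the pair of endpoints when the cycle closes. Old adjacencies survive, since
  every newly exposed edge has an endpoint outside the old vertex range.\<close>

lemma has_induced_extend_prob:
  assumes p: "0 \<le> p" "p \<le> 1" and N: "N \<le> N'" and a: "a \<le> prob_G N p (has_induced adj i N)"
    and T: "T \<subseteq> {..<i}" and adj: "\<And>j j'. j < j' \<Longrightarrow> j' < i \<Longrightarrow> adj j j' = adj' j j'"
    and adjT: "\<And>j. j < i \<Longrightarrow> adj' j i \<longleftrightarrow> j \<in> T"
  shows "a * (1 - (1 - p ^ card T * (1 - p) ^ (i - card T)) ^ (N' - N)) \<le>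
    prob_G N' p (has_induced adj' (Suc i) N')"
proof (rule prob_G_extend[OF N p a])
  have "p ^ card T * (1 - p) ^ (i - card T) \<le> 1 * 1" 
    using p by (intro mult_mono power_le_one) auto
  moreover have "0 \<le> p ^ card T * (1 - p) ^ (i - card T)" using p by simp
  ultimately show "0 \<le> 1 - (1 - p ^ card T * (1 - p) ^ (i - card T)) ^ (N' - N)"
    by (simp add: power_le_one)
next
  fix E assume E: "E \<subseteq> all_edges N" and "has_induced adj i N E"
  then obtain c where c: "inj_on c {..<i}" "\<And>j. j < i \<Longrightarrow> c j < N"
    "\<And>j j'. j < j' \<Longrightarrow> j' < i \<Longrightarrow> {c j, c j'} \<in> E \<longleftrightarrow> adj j j'"
    unfolding has_induced_def by blast
  have "1 - (1 - p ^ card T * (1 - p) ^ (i - card T)) ^ (N' - N) \<le>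
    bern (all_edges N' - all_edges N) p (\<lambda>E. \<exists>v\<in>{N..<N'}. \<forall>j<i. {c j, v} \<in> E \<longleftrightarrow> j \<in> T)"
    by (rule vertex_extension_prob[OF p c(1,2) T N])
  also have "\<dots> \<le> bern (all_edges N' - all_edges N) p (\<lambda>E'. has_induced adj' (Suc i) N' (E \<union> E'))"
  proof (rule bern_mono[OF p])
    fix E' assume E': "E' \<subseteq> all_edges N' - all_edges N"
      and "\<exists>v\<in>{N..<N'}. \<forall>j<i. {c j, v} \<in> E' \<longleftrightarrow> j \<in> T"
    then obtain v where v: "N \<le> v" "v < N'" "\<And>j. j < i \<Longrightarrow> {c j, v} \<in> E' \<longleftrightarrow> j \<in> T" by auto
    have old: "{c j, c j'} \<notin> E'" if "j < i" "j' < i" for j j'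
    proof
      assume "{c j, c j'} \<in> E'"
      then have "{c j, c j'} \<in> all_edges N'" "{c j, c j'} \<notin> all_edges N" using E' by auto
      then show False using c(2)[OF that(1)] c(2)[OF that(2)] by (simp add: doubleton_in_all_edges_iff)
    qed
    have new: "{c j, v} \<notin> E" if "j < i" for j
      using E v(1) doubleton_in_all_edges_iff[of "c j" v N] by auto
    show "has_induced adj' (Suc i) N' (E \<union> E')"
      unfolding has_induced_def
    proof (intro exI[of _ "c(i := v)"] conjI allI impI)
      show "inj_on (c(i := v)) {..<Suc i}"
        using c(1,2) v(1) by (fastforce simp: inj_on_def less_Suc_eq)
      show "(c(i := v)) j < N'" if "j < Suc i" for j
        using that c(2)[of j] v N by (auto simp: less_Suc_eq)
      show "({(c(i := v)) j, (c(i := v)) j'} \<in> E \<union> E') = adj' j j'" if "j < j'" "j' < Suc i" for j j'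
      proof (cases "j' = i")
        case True
        then show ?thesis using that v(3)[of j] new[of j] adjT[of j] by auto
      next
        case False
        then show ?thesis using that c(3)[of j j'] old[of j j'] adj[of j j'] by auto
      qed
    qed
  qed
  finally show "1 - (1 - p ^ card T * (1 - p) ^ (i - card T)) ^ (N' - N) \<le>
    bern (all_edges N' - all_edges N) p (\<lambda>E'. has_induced adj' (Suc i) N' (E \<union> E'))" .
qed

text \<open>Each vertex is sought in a fresh block of \<open>L\<close> vertices, and the search
  fails with probability at most \<open>(1 - h) ^ L\<close>, as \<open>h\<close> is below the
  success probability at every length. The failures add up.\<close>

lemma induced_path_prob:
  assumes p: "0 \<le> p" "p \<le> 1" and i: "1 \<le> i" and h: "h \<le> p * (1 - p) ^ i" "0 \<le> h" and L: "L \<ge> 1"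
  shows "1 - real i * (1 - h) ^ L \<le> prob_G (i * L) p (has_induced (\<lambda>j j'. j' = Suc j) i (i * L))"
  using i h
proof (induction i rule: dec_induct)
  case base
  have h1: "h \<le> 1" using base p by (simp add: mult_le_one order_trans)
  have "prob_G (1 * L) p (has_induced (\<lambda>j j'. j' = Suc j) 1 (1 * L)) = prob_G (1 * L) p (\<lambda>_. True)"
    unfolding prob_G_eq_bern
    by (intro bern_cong) (use L in \<open>auto simp: has_induced_def inj_on_def intro!: exI[of _ "\<lambda>_. 0"]\<close>)
  also have "\<dots> = 1" by (simp add: prob_G_eq_bern bern_True finite_all_edges)
  finally show ?case using h1 by simp
next
  case (step i)
  have ii: "(1 - p) ^ Suc i \<le> (1 - p) ^ i" "(1 - p) ^ i \<le> (1 - p) ^ (i - 1)" using p by (auto intro!: power_decreasing simp del: power_Suc)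
  have hi: "h \<le> p * (1 - p) ^ i" using step.prems ii p mult_left_mono[OF ii(1), of p] by linarith
  have hi1: "h \<le> p * (1 - p) ^ (i - 1)" using hi p mult_left_mono[OF ii(2), of p] by linarith
  have IH: "1 - real i * (1 - h) ^ L \<le> prob_G (i * L) p (has_induced (\<lambda>j j'. j' = Suc j) i (i * L))"
    using step.IH hi step.prems by simp
  define a where "a = prob_G (i * L) p (has_induced (\<lambda>j j'. j' = Suc j) i (i * L))"
  have a: "0 \<le> a" "a \<le> 1"
  proof -
    show "0 \<le> a" unfolding a_def prob_G_eq_bern by (rule bern_nonneg[OF p])
    have "a \<le> bern (all_edges (i * L)) p (\<lambda>_. True)" unfolding a_def prob_G_eq_bern by (rule bern_mono[OF p]) auto
    then show "a \<le> 1" by (simp add: bern_True finite_all_edges)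
  qed
  have "a * (1 - (1 - p ^ card {i - 1} * (1 - p) ^ (i - card {i - 1})) ^ (Suc i * L - i * L)) \<le>
     prob_G (Suc i * L) p (has_induced (\<lambda>j j'. j' = Suc j) (Suc i) (Suc i * L))"
    by (rule has_induced_extend_prob[OF p]) (use step.hyps in \<open>auto simp: a_def\<close>)
  then have st: "a * (1 - (1 - p * (1 - p) ^ (i - 1)) ^ L) \<le>
     prob_G (Suc i * L) p (has_induced (\<lambda>j j'. j' = Suc j) (Suc i) (Suc i * L))" by simp
  have q1: "p * (1 - p) ^ (i - 1) \<le> 1" using p by (intro mult_le_one power_le_one) auto
  have mono: "(1 - p * (1 - p) ^ (i - 1)) ^ L \<le> (1 - h) ^ L" using hi1 q1 by (intro power_mono) auto
  have h1: "0 \<le> (1 - h) ^ L" using hi1 q1 by simp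
  \<comment> \<open>The product a (1 - y) is at least a - y because \<open>a\<close> is at most 1;
    this turns the product of the rounds into a union bound.\<close>
  have "1 - real (Suc i) * (1 - h) ^ L \<le> a - (1 - h) ^ L" using IH by (simp add: a_def algebra_simps)
  also have "\<dots> \<le> a - a * (1 - h) ^ L" using mult_right_mono[OF a(2) h1] by simp
  also have "\<dots> \<le> a * (1 - (1 - p * (1 - p) ^ (i - 1)) ^ L)" using mult_left_mono[OF mono a(1)] by (simp add: algebra_simps)
  finally show ?case using st by simp
qed

text \<open>The closing vertex must see both endpoints 0 and \<open>2 * r - 1\<close> of the path
  and miss the other \<open>2 * r - 2\<close> vertices. Its success probability is only of order
  p^2, so it gets all the remaining \<open>N - 2 * r * L\<close> vertices.\<close>

lemma induced_odd_cycle_prob: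
  assumes p: "0 \<le> p" "p \<le> 1" and r: "1 \<le> r" and L: "L \<ge> 1"
    and h: "h \<le> (1 - p) ^ (2 * r)" "0 \<le> h" and N: "2 * r * L \<le> N"
    and x: "0 \<le> 1 - real (2 * r) * (1 - p * h) ^ L" 
  shows "(1 - real (2 * r) * (1 - p * h) ^ L) * (1 - (1 - p\<^sup>2 * h) ^ (N - 2 * r * L)) \<le>
    prob_G N p (has_induced (cyc_adj (2 * r + 1)) (2 * r + 1) N)"
proof -
  have path: "1 - real (2 * r) * (1 - p * h) ^ L \<le>
      prob_G (2 * r * L) p (has_induced (\<lambda>j j'. j' = Suc j) (2 * r) (2 * r * L))"
    by (rule induced_path_prob[OF p]) (use r L h p in \<open>auto intro: mult_left_mono\<close>)
  have T: "card {0, 2 * r - 1} = 2" using r by auto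
  have "(1 - real (2 * r) * (1 - p * h) ^ L) *
      (1 - (1 - p ^ card {0, 2 * r - 1} * (1 - p) ^ (2 * r - card {0, 2 * r - 1})) ^ (N - 2 * r * L)) \<le>
      prob_G N p (has_induced (cyc_adj (2 * r + 1)) (Suc (2 * r)) N)"
    by (rule has_induced_extend_prob[OF p N path]) (use r in \<open>auto simp: cyc_adj_def\<close>)
  moreover have "(1 - p\<^sup>2 * (1 - p) ^ (2 * r - 2)) ^ (N - 2 * r * L) \<le> (1 - p\<^sup>2 * h) ^ (N - 2 * r * L)"
  proof (intro power_mono diff_left_mono mult_left_mono)
    have "(1 - p) ^ (2 * r) \<le> (1 - p) ^ (2 * r - 2)" using p by (intro power_decreasing) auto
    then show "h \<le> (1 - p) ^ (2 * r - 2)" using h by simp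
    have "p\<^sup>2 * (1 - p) ^ (2 * r - 2) \<le> 1" using p by (intro mult_le_one power_le_one) auto
    then show "0 \<le> 1 - p\<^sup>2 * (1 - p) ^ (2 * r - 2)" by simp
  qed simp
  then have "(1 - real (2 * r) * (1 - p * h) ^ L) * (1 - (1 - p\<^sup>2 * h) ^ (N - 2 * r * L)) \<le>
    (1 - real (2 * r) * (1 - p * h) ^ L) * (1 - (1 - p\<^sup>2 * (1 - p) ^ (2 * r - 2)) ^ (N - 2 * r * L))"
    using x by (intro mult_left_mono) auto
  ultimately show ?thesis using T by simp
qed

subsection \<open>Attaching an independent set of pendant vertices\<close>

text \<open>Two compatible cylinders form one cylinder on the unions, and the sizes of unions and
  intersections add up to the sum of the sizes. Incompatible cylinders have joint probability 0,
  which is why \<open>y\<close> needs to bound the overlap only in the compatible case.\<close>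

lemma bern_joint_cylinder:
  assumes fin: "finite F" and p: "0 < p" "p < 1"
    and sub: "X \<subseteq> F" "Y \<subseteq> F" "X' \<subseteq> F" "Y' \<subseteq> F" and disj: "X \<inter> Y = {}" "X' \<inter> Y' = {}"
    and x: "card (X \<inter> X') \<le> x" and y: "X \<inter> Y' = {} \<Longrightarrow> X' \<inter> Y = {} \<Longrightarrow> card (Y \<inter> Y') \<le> y"
  shows "bern F p (\<lambda>E. (X \<subseteq> E \<and> Y \<inter> E = {}) \<and> (X' \<subseteq> E \<and> Y' \<inter> E = {})) \<le>
    (p ^ card X * (1 - p) ^ card Y) * (p ^ card X' * (1 - p) ^ card Y') / (p ^ x * (1 - p) ^ y)"
proof (cases "X \<inter> Y' = {} \<and> X' \<inter> Y = {}")
  case True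
  have f: "finite X" "finite Y" "finite X'" "finite Y'" using fin sub by (blast intro: finite_subset)+
  have "bern F p (\<lambda>E. (X \<subseteq> E \<and> Y \<inter> E = {}) \<and> (X' \<subseteq> E \<and> Y' \<inter> E = {})) =
    bern F p (\<lambda>E. X \<union> X' \<subseteq> E \<and> (Y \<union> Y') \<inter> E = {})"
    by (intro bern_cong) blast
  also have "\<dots> = p ^ card (X \<union> X') * (1 - p) ^ card (Y \<union> Y')"
    using fin sub disj True by (intro bern_cylinder) auto
  finally have eq: "bern F p (\<lambda>E. (X \<subseteq> E \<and> Y \<inter> E = {}) \<and> (X' \<subseteq> E \<and> Y' \<inter> E = {})) =
    p ^ card (X \<union> X') * (1 - p) ^ card (Y \<union> Y')" .
  have "p ^ card (X \<union> X') * (1 - p) ^ card (Y \<union> Y') * (p ^ x * (1 - p) ^ y) \<le>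
    p ^ card (X \<union> X') * (1 - p) ^ card (Y \<union> Y') * (p ^ card (X \<inter> X') * (1 - p) ^ card (Y \<inter> Y'))"
    using p x y True by (intro mult_left_mono mult_mono power_decreasing) auto
  also have "\<dots> = p ^ (card (X \<union> X') + card (X \<inter> X')) * (1 - p) ^ (card (Y \<union> Y') + card (Y \<inter> Y'))"
    by (simp add: power_add mult_ac)
  also have "\<dots> = p ^ (card X + card X') * (1 - p) ^ (card Y + card Y')"
    using card_Un_Int[of X X'] card_Un_Int[of Y Y'] f by simp
  also have "\<dots> = (p ^ card X * (1 - p) ^ card Y) * (p ^ card X' * (1 - p) ^ card Y')"
    by (simp add: power_add mult_ac)
  finally show ?thesis unfolding eq using p by (simp add: le_divide_eq)
next
  case False
  then have "bern F p (\<lambda>E. (X \<subseteq> E \<and> Y \<inter> E = {}) \<and> (X' \<subseteq> E \<and> Y' \<inter> E = {})) = bern F p (\<lambda>_. False)"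
    by (intro bern_cong) blast
  also have "\<dots> = 0" by (simp add: bern_def)
  finally show ?thesis using p by simp
qed

text \<open>The functions \<open>\<beta>'\<close> are grouped by the set on which they agree with
  \<open>\<beta>\<close>. For a set of size l there are at most |B|^(k - l) of them, since the
  values off that set determine \<open>\<beta>'\<close>.\<close>

lemma sum_over_agreement:
  fixes W :: "nat \<Rightarrow> real"
  assumes finB: "finite B" and \<beta>: "\<beta> \<in> {..<k} \<rightarrow>\<^sub>E B" and W: "\<And>l. 0 \<le> W l"
  shows "(\<Sum>\<beta>'\<in>{..<k} \<rightarrow>\<^sub>E B. W (card {i\<in>{..<k}. \<beta> i = \<beta>' i})) \<le>
    (\<Sum>l\<le>k. real (k choose l) * real (card B) ^ (k - l) * W l)"
proof -
  let ?\<Omega> = "{..<k} \<rightarrow>\<^sub>E B" and ?S = "\<lambda>\<beta>'. {i\<in>{..<k}. \<beta> i = \<beta>' i}"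
  have fin: "finite ?\<Omega>" using finB by (intro finite_PiE) auto
  have cnt: "card {\<beta>'\<in>?\<Omega>. ?S \<beta>' = S} \<le> card B ^ (k - card S)" if S: "S \<subseteq> {..<k}" for S
  proof -
    have "card {\<beta>'\<in>?\<Omega>. ?S \<beta>' = S} \<le> card (({..<k} - S) \<rightarrow>\<^sub>E B)"
    proof (rule card_inj_on_le[where f = "\<lambda>\<beta>'. restrict \<beta>' ({..<k} - S)"])
      show "inj_on (\<lambda>\<beta>'. restrict \<beta>' ({..<k} - S)) {\<beta>'\<in>?\<Omega>. ?S \<beta>' = S}"
      proof (rule inj_onI)
        fix g h assume g: "g \<in> {\<beta>'\<in>?\<Omega>. ?S \<beta>' = S}" and h: "h \<in> {\<beta>'\<in>?\<Omega>. ?S \<beta>' = S}"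
          and e: "restrict g ({..<k} - S) = restrict h ({..<k} - S)"
        show "g = h"
        proof (rule PiE_ext[of g "{..<k}" "\<lambda>_. B" h])
          fix i assume i: "i \<in> {..<k}"
          show "g i = h i"
          proof (cases "i \<in> S")
            case True
            then have "i \<in> ?S g" "i \<in> ?S h" using g h by auto
            then show ?thesis by simp
          next
            case False
            then show ?thesis using fun_cong[OF e, of i] i by simp
          qed
        qed (use g h in auto)
      qed
      show "(\<lambda>\<beta>'. restrict \<beta>' ({..<k} - S)) ` {\<beta>'\<in>?\<Omega>. ?S \<beta>' = S} \<subseteq> ({..<k} - S) \<rightarrow>\<^sub>E B"
      proof (rule image_subsetI)
        fix g assume "g \<in> {\<beta>'\<in>?\<Omega>. ?S \<beta>' = S}"
        then have "g \<in> ?\<Omega>" by (rule CollectE) (rule conjunct1)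
        then show "restrict g ({..<k} - S) \<in> ({..<k} - S) \<rightarrow>\<^sub>E B"
          unfolding restrict_PiE_iff by (intro ballI PiE_mem[of g "{..<k}" "\<lambda>_. B"]) auto
      qed
      show "finite (({..<k} - S) \<rightarrow>\<^sub>E B)" using finB by (intro finite_PiE) auto
    qed
    also have "\<dots> = card B ^ (k - card S)"
      using S finite_subset[OF S] by (simp add: card_PiE card_Diff_subset)
    finally show ?thesis .
  qed
  have "(\<Sum>\<beta>'\<in>?\<Omega>. W (card (?S \<beta>'))) =
    (\<Sum>S\<in>Pow {..<k}. \<Sum>\<beta>'\<in>{\<beta>'\<in>?\<Omega>. ?S \<beta>' = S}. W (card (?S \<beta>')))"
    using fin by (intro sum.group[symmetric]) auto
  also have "\<dots> = (\<Sum>S\<in>Pow {..<k}. real (card {\<beta>'\<in>?\<Omega>. ?S \<beta>' = S}) * W (card S))"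
    by (intro sum.cong refl) simp
  also have "\<dots> \<le> (\<Sum>S\<in>Pow {..<k}. real (card B) ^ (k - card S) * W (card S))"
    using cnt W by (intro sum_mono mult_right_mono) (auto simp flip: of_nat_power)
  also have "\<dots> = (\<Sum>l\<le>k. \<Sum>S\<in>{S\<in>Pow {..<k}. card S = l}. real (card B) ^ (k - card S) * W (card S))"
    by (intro sum.group[symmetric]) (auto intro: card_mono[of "{..<k}", simplified])
  also have "\<dots> = (\<Sum>l\<le>k. real (k choose l) * real (card B) ^ (k - l) * W l)"
  proof (intro sum.cong refl)
    fix l
    have "card {S\<in>Pow {..<k}. card S = l} = k choose l" using n_subsets[of "{..<k}" l] by simp
    then show "(\<Sum>S\<in>{S\<in>Pow {..<k}. card S = l}. real (card B) ^ (k - card S) * W (card S)) =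
      real (k choose l) * real (card B) ^ (k - l) * W l" by simp
  qed
  finally show ?thesis .
qed

definition has_pendants :: "(nat \<Rightarrow> nat) \<Rightarrow> nat \<Rightarrow> nat \<Rightarrow> nat \<Rightarrow> nat \<Rightarrow> nat set set \<Rightarrow> bool" where
  "has_pendants c m N n k E \<longleftrightarrow> (\<exists>b a. inj_on b {..<k} \<and> (\<forall>i<k. N \<le> b i \<and> b i < n \<and> a i < m) \<and>
     (\<forall>i<k. \<forall>j<m. {b i, c j} \<in> E \<longleftrightarrow> j = a i) \<and> (\<forall>i<k. \<forall>i'<k. i \<noteq> i' \<longrightarrow> {b i, b i'} \<notin> E))"

text \<open>A candidate \<open>\<beta>\<close> picks for each block \<open>i\<close> a vertex and
  the cycle index to which it is attached. The quantity inverted in \<open>R\<close> is the expected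
  number of good picks in one block, and the power of 1 - p belongs to the non-edges among the l
  picks that two candidates share.\<close>

lemma has_pendants_prob:
  fixes c :: "nat \<Rightarrow> nat"
  assumes p: "0 < p" "p < 1" and m: "1 \<le> m" and inj: "inj_on c {..<m}" and c: "\<And>j. j < m \<Longrightarrow> c j < N"
    and LB: "1 \<le> LB" and n: "N + k * LB \<le> n"
  defines "R \<equiv> (\<Sum>l\<le>k. real (k choose l) * (1 / (real (LB * m) * (p * (1 - p) ^ (m - 1)))) ^ l / (1 - p) ^ (l choose 2))"
  shows "1 \<le> R * bern (all_edges n - all_edges N) p (has_pendants c m N n k)"
proof -
  let ?F = "all_edges n - all_edges N"
  define \<Omega> where "\<Omega> = {..<k} \<rightarrow>\<^sub>E ({..<LB} \<times> {..<m})"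
  \<comment> \<open>Block \<open>i\<close> starts at \<open>N + i * LB\<close>. Private blocks make
    the picks distinct automatically, and two candidates can share a vertex only at the same index
    \<open>i\<close>.\<close>
  define b where "b \<beta> i = N + i * LB + fst (\<beta> i)" for \<beta> :: "nat \<Rightarrow> nat \<times> nat" and i
  \<comment> \<open>Required edges are in \<open>X\<close>, forbidden ones in \<open>Y1\<close> (to
    the cycle) and \<open>Y2\<close> (between pendants). The index set \<open>S\<close> is kept as a
    parameter because the overlap of two candidates is bounded by the same sets over their agreement
    set.\<close>
  define X where "X \<beta> = (\<lambda>i. {b \<beta> i, c (snd (\<beta> i))}) ` {..<k}" for \<beta>
  define Y1 where "Y1 \<beta> S = (\<lambda>(i, j). {b \<beta> i, c j}) ` (SIGMA i:S. {..<m} - {snd (\<beta> i)})" for \<beta> S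
  define Y2 where "Y2 \<beta> S = (\<lambda>T. b \<beta> ` T) ` {T. T \<subseteq> S \<and> card T = 2}" for \<beta> S
  define Y where "Y \<beta> = Y1 \<beta> {..<k} \<union> Y2 \<beta> {..<k}" for \<beta>
  have \<Omega>D: "fst (\<beta> i) < LB" "snd (\<beta> i) < m" if "\<beta> \<in> \<Omega>" "i < k" for \<beta> i
  proof -
    have "\<beta> i \<in> {..<LB} \<times> {..<m}" using that by (auto simp: \<Omega>_def)
    then show "fst (\<beta> i) < LB" "snd (\<beta> i) < m" by auto
  qed
  have b_eq: "b \<beta> i = b \<beta>' i' \<longleftrightarrow> i = i' \<and> fst (\<beta> i) = fst (\<beta>' i')"
    if "\<beta> \<in> \<Omega>" "\<beta>' \<in> \<Omega>" "i < k" "i' < k" for \<beta> \<beta>' i i'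
  proof
    assume "b \<beta> i = b \<beta>' i'"
    then have e: "i * LB + fst (\<beta> i) = i' * LB + fst (\<beta>' i')" by (simp add: b_def)
    have "(i * LB + fst (\<beta> i)) div LB = i" "(i' * LB + fst (\<beta>' i')) div LB = i'"
      using \<Omega>D[OF that(1,3)] \<Omega>D[OF that(2,4)] LB by auto
    then show "i = i' \<and> fst (\<beta> i) = fst (\<beta>' i')" using e by auto
  qed (auto simp: b_def)
  have b_ge: "N \<le> b \<beta> i" for \<beta> i by (simp add: b_def)
  have b_lt: "b \<beta> i < n" if "\<beta> \<in> \<Omega>" "i < k" for \<beta> i
  proof -
    have "b \<beta> i < N + (i * LB + LB)" using \<Omega>D[OF that] by (simp add: b_def)
    also have "i * LB + LB \<le> k * LB" using that(2) mult_le_mono1[of "Suc i" k LB] by simp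
    finally show ?thesis using n by simp
  qed
  have bc: "b \<beta> i \<noteq> c j" if "j < m" for \<beta> i j using b_ge[of \<beta> i] c[OF that] by simp
  have c_eq: "c j = c j' \<longleftrightarrow> j = j'" if "j < m" "j' < m" for j j' using inj that by (auto simp: inj_on_def)
  have e_eq: "{b \<beta> i, c j} = {b \<beta>' i', c j'} \<longleftrightarrow> i = i' \<and> fst (\<beta> i) = fst (\<beta>' i') \<and> j = j'"
    if "\<beta> \<in> \<Omega>" "\<beta>' \<in> \<Omega>" "i < k" "i' < k" "j < m" "j' < m" for \<beta> \<beta>' i i' j j'
    using that bc[of j \<beta>' i'] bc[of j' \<beta> i] b_eq[of \<beta> \<beta>' i i'] c_eq[of j j'] by (auto simp: doubleton_eq_iff)
  have b_inj: "inj_on (b \<beta>) {..<k}" if "\<beta> \<in> \<Omega>" for \<beta>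
    using b_eq[OF that that] by (auto simp: inj_on_def)
  have edge: "{b \<beta> i, c j} \<noteq> b \<beta>' ` T" if "j < m" for \<beta> \<beta>' i j T
  proof
    assume "{b \<beta> i, c j} = b \<beta>' ` T"
    then have "c j \<in> b \<beta>' ` T" by blast
    then obtain t where "c j = b \<beta>' t" by (rule imageE)
    then show False using bc[of j \<beta>' t] that by simp
  qed
  have Xsub: "X \<beta> \<subseteq> ?F" if \<beta>: "\<beta> \<in> \<Omega>" for \<beta>
  proof
    fix e assume "e \<in> X \<beta>"
    then obtain i where i: "i < k" "e = {b \<beta> i, c (snd (\<beta> i))}" by (auto simp: X_def)
    note j = \<Omega>D(2)[OF \<beta> i(1)]
    show "e \<in> ?F" using i b_ge[of \<beta> i] b_lt[OF \<beta> i(1)] c[OF j] bc[OF j]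
      by (auto simp: doubleton_in_all_edges_iff)
  qed
  have Ysub: "Y \<beta> \<subseteq> ?F" if \<beta>: "\<beta> \<in> \<Omega>" for \<beta>
  proof
    fix e assume "e \<in> Y \<beta>"
    then consider i j where "i < k" "j < m" "e = {b \<beta> i, c j}" | T where "T \<subseteq> {..<k}" "card T = 2" "e = b \<beta> ` T"
      by (auto simp: Y_def Y1_def Y2_def)
    then show "e \<in> ?F"
    proof cases
      case 1
      then show ?thesis using b_ge[of \<beta> i] b_lt[OF \<beta> 1(1)] c[OF 1(2)] bc[OF 1(2)]
        by (auto simp: doubleton_in_all_edges_iff)
    next
      case 2
      then obtain i i' where T: "T = {i, i'}" "i \<noteq> i'" by (auto simp: card_2_iff)
      then have "i < k" "i' < k" using 2 by auto
      then show ?thesis using 2 T b_lt[OF \<beta>, of i] b_lt[OF \<beta>, of i'] b_ge[of \<beta> i] b_eq[OF \<beta> \<beta>, of i i']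
        by (auto simp: doubleton_in_all_edges_iff)
    qed
  qed
  have XY: "X \<beta> \<inter> Y \<beta> = {}" if \<beta>: "\<beta> \<in> \<Omega>" for \<beta>
  proof -
    have "{b \<beta> i, c (snd (\<beta> i))} \<noteq> {b \<beta> i', c j}" if "i < k" "i' < k" "j < m" "j \<noteq> snd (\<beta> i')" for i i' j
      using e_eq[OF \<beta> \<beta> that(1,2) \<Omega>D(2)[OF \<beta> that(1)] that(3)] that by auto
    then have "X \<beta> \<inter> Y1 \<beta> {..<k} = {}" unfolding X_def Y1_def by fastforce
    moreover have "X \<beta> \<inter> Y2 \<beta> {..<k} = {}" unfolding X_def Y2_def using edge \<Omega>D(2)[OF \<beta>] by fastforce
    ultimately show ?thesis by (auto simp: Y_def)
  qed
  have cX: "card (X \<beta>) = k" if \<beta>: "\<beta> \<in> \<Omega>" for \<beta>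
  proof -
    have "inj_on (\<lambda>i. {b \<beta> i, c (snd (\<beta> i))}) {..<k}"
      using e_eq[OF \<beta> \<beta>] \<Omega>D(2)[OF \<beta>] by (auto simp: inj_on_def)
    then show ?thesis unfolding X_def by (simp add: card_image)
  qed
  have cSig: "card (SIGMA i:S. {..<m} - {snd (\<beta> i)}) = card S * (m - 1)" if \<beta>: "\<beta> \<in> \<Omega>" and S: "S \<subseteq> {..<k}" for \<beta> S
  proof -
    have "card (SIGMA i:S. {..<m} - {snd (\<beta> i)}) = (\<Sum>i\<in>S. card ({..<m} - {snd (\<beta> i)}))"
      using finite_subset[OF S] by (intro card_SigmaI) auto
    also have "\<dots> = (\<Sum>i\<in>S. m - 1)"
      using S \<Omega>D(2)[OF \<beta>] by (intro sum.cong refl) auto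
    finally show ?thesis by simp
  qed
  have cY: "card (Y \<beta>) = k * (m - 1) + (k choose 2)" if \<beta>: "\<beta> \<in> \<Omega>" for \<beta>
  proof -
    have "inj_on (\<lambda>(i, j). {b \<beta> i, c j}) (SIGMA i:{..<k}. {..<m} - {snd (\<beta> i)})"
      using e_eq[OF \<beta> \<beta>] by (auto simp: inj_on_def)
    then have 1: "card (Y1 \<beta> {..<k}) = k * (m - 1)"
      unfolding Y1_def using cSig[OF \<beta>, of "{..<k}"] by (simp add: card_image)
    have "inj_on (\<lambda>T. b \<beta> ` T) {T. T \<subseteq> {..<k} \<and> card T = 2}"
      using inj_on_image_Pow[OF b_inj[OF \<beta>]] by (rule inj_on_subset) auto
    then have 2: "card (Y2 \<beta> {..<k}) = k choose 2"
      unfolding Y2_def using n_subsets[of "{..<k}" 2] by (simp add: card_image)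
    have "Y1 \<beta> {..<k} \<inter> Y2 \<beta> {..<k} = {}" unfolding Y1_def Y2_def using edge by fastforce
    moreover have "finite (Y1 \<beta> {..<k})" "finite (Y2 \<beta> {..<k})" unfolding Y1_def Y2_def by auto
    ultimately show ?thesis unfolding Y_def by (simp add: card_Un_disjoint 1 2)
  qed
  define A where "A \<beta> E \<longleftrightarrow> X \<beta> \<subseteq> E \<and> Y \<beta> \<inter> E = {}" for \<beta> E
  define \<pi> where "\<pi> = p ^ k * (1 - p) ^ (k * (m - 1) + (k choose 2))"
  define agree where "agree \<beta> \<beta>' = {i\<in>{..<k}. \<beta> i = \<beta>' i}" for \<beta> \<beta>' :: "nat \<Rightarrow> nat \<times> nat"
  define W where "W l = 1 / (p ^ l * (1 - p) ^ (l * (m - 1) + (l choose 2)))" for l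
  have W0: "0 \<le> W l" for l using p by (simp add: W_def)
  have finF: "finite ?F" by (simp add: finite_all_edges)
  have first: "bern ?F p (A \<beta>) = \<pi>" if "\<beta> \<in> \<Omega>" for \<beta>
    using bern_cylinder[OF finF Xsub[OF that] Ysub[OF that] XY[OF that]] cX[OF that] cY[OF that]
    by (simp add: A_def[abs_def] \<pi>_def)
  have joint: "bern ?F p (\<lambda>E. A \<beta> E \<and> A \<beta>' E) \<le> \<pi>\<^sup>2 * W (card (agree \<beta> \<beta>'))" if \<beta>: "\<beta> \<in> \<Omega>" and \<beta>': "\<beta>' \<in> \<Omega>" for \<beta> \<beta>'
  proof -
    let ?S = "agree \<beta> \<beta>'"
    have S: "?S \<subseteq> {..<k}" "finite ?S" by (auto simp: agree_def)
    have "X \<beta> \<inter> X \<beta>' \<subseteq> (\<lambda>i. {b \<beta> i, c (snd (\<beta> i))}) ` ?S"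
    proof
      fix e assume "e \<in> X \<beta> \<inter> X \<beta>'"
      then obtain i i' where i: "i < k" "i' < k" "e = {b \<beta> i, c (snd (\<beta> i))}" "e = {b \<beta>' i', c (snd (\<beta>' i'))}"
        by (auto simp: X_def)
      have "i = i' \<and> fst (\<beta> i) = fst (\<beta>' i') \<and> snd (\<beta> i) = snd (\<beta>' i')"
        by (rule iffD1[OF e_eq[OF \<beta> \<beta>' i(1,2) \<Omega>D(2)[OF \<beta> i(1)] \<Omega>D(2)[OF \<beta>' i(2)]] trans[OF i(3)[symmetric] i(4)]])
      then have "i \<in> ?S" using i by (auto simp: agree_def prod_eq_iff)
      then show "e \<in> (\<lambda>i. {b \<beta> i, c (snd (\<beta> i))}) ` ?S" using i by auto
    qed
    then have x: "card (X \<beta> \<inter> X \<beta>') \<le> card ?S"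
      using surj_card_le[OF S(2)] by blast
    have y: "card (Y \<beta> \<inter> Y \<beta>') \<le> card ?S * (m - 1) + (card ?S choose 2)" if compat: "X \<beta> \<inter> Y \<beta>' = {}"
    proof -
      \<comment> \<open>The same vertex with a different attachment would make an edge required by
        \<open>\<beta>\<close> forbidden by \<open>\<beta>'\<close>. For compatible candidates,
        sharing the vertex in block \<open>i\<close> therefore means sharing the whole pick.\<close>
      have agr: "i \<in> ?S" if i: "i < k" "fst (\<beta> i) = fst (\<beta>' i)" for i
      proof (rule ccontr)
        assume "i \<notin> ?S"
        then have ne: "snd (\<beta> i) \<noteq> snd (\<beta>' i)" using i by (auto simp: agree_def prod_eq_iff)
        have "b \<beta> i = b \<beta>' i" using i by (simp add: b_def)
        then have "{b \<beta> i, c (snd (\<beta> i))} \<in> Y \<beta>'"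
          unfolding Y_def Y1_def using i ne \<Omega>D(2)[OF \<beta> i(1)]
          by (intro UnI1 image_eqI[of _ _ "(i, snd (\<beta> i))"]) auto
        moreover have "{b \<beta> i, c (snd (\<beta> i))} \<in> X \<beta>" using i by (auto simp: X_def)
        ultimately show False using compat by blast
      qed
      have "Y \<beta> \<inter> Y \<beta>' \<subseteq> Y1 \<beta> ?S \<union> Y2 \<beta> ?S"
      proof
        fix e assume e: "e \<in> Y \<beta> \<inter> Y \<beta>'"
        show "e \<in> Y1 \<beta> ?S \<union> Y2 \<beta> ?S"
        proof (cases "e \<in> Y1 \<beta> {..<k}")
          case True
          then obtain i j where i: "i < k" "j < m" "j \<noteq> snd (\<beta> i)" "e = {b \<beta> i, c j}" by (auto simp: Y1_def)
          have "e \<notin> Y2 \<beta>' {..<k}" using edge[OF i(2)] i(4) by (auto simp: Y2_def)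
          then have "e \<in> Y1 \<beta>' {..<k}" using e by (auto simp: Y_def)
          then obtain i' j' where i': "i' < k" "j' < m" "e = {b \<beta>' i', c j'}" by (auto simp: Y1_def)
          have "i = i' \<and> fst (\<beta> i) = fst (\<beta>' i')"
            using iffD1[OF e_eq[OF \<beta> \<beta>' i(1) i'(1) i(2) i'(2)] trans[OF i(4)[symmetric] i'(3)]] by blast
          then have "i \<in> ?S" using agr i by blast
          then show ?thesis using i by (auto simp: Y1_def intro!: image_eqI[of _ _ "(i, j)"])
        next
          case False
          then obtain T where T: "T \<subseteq> {..<k}" "card T = 2" "e = b \<beta> ` T" using e by (auto simp: Y_def Y2_def)
          have "e \<notin> Y1 \<beta>' {..<k}"
          proof
            assume "e \<in> Y1 \<beta>' {..<k}"
            then obtain i j where "j < m" "e = {b \<beta>' i, c j}" by (auto simp: Y1_def)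
            then show False using edge[of j \<beta>' i \<beta> T] T(3) by simp
          qed
          then obtain T' where T': "T' \<subseteq> {..<k}" "e = b \<beta>' ` T'" using e by (auto simp: Y_def Y2_def)
          \<comment> \<open>A forbidden pair common to both candidates has both of its ends in
            common, so both blocks are blocks of agreement.\<close>
          have "T \<subseteq> ?S"
          proof
            fix i assume i: "i \<in> T"
            then have "b \<beta> i \<in> b \<beta>' ` T'" using T T' by auto
            then obtain i' where i': "i' \<in> T'" "b \<beta> i = b \<beta>' i'" by auto
            then have "i = i' \<and> fst (\<beta> i) = fst (\<beta>' i')" using b_eq[OF \<beta> \<beta>', of i i'] i T(1) T'(1) by blast
            then show "i \<in> ?S" using agr i T by auto
          qed
          then show ?thesis using T by (auto simp: Y2_def)
        qed
      qed
      then have "card (Y \<beta> \<inter> Y \<beta>') \<le> card (Y1 \<beta> ?S \<union> Y2 \<beta> ?S)"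
        using S by (intro card_mono) (auto simp: Y1_def Y2_def)
      also have "\<dots> \<le> card (Y1 \<beta> ?S) + card (Y2 \<beta> ?S)" by (rule card_Un_le)
      also have "card (Y1 \<beta> ?S) \<le> card ?S * (m - 1)"
        unfolding Y1_def cSig[OF \<beta> S(1), symmetric] using S by (intro card_image_le) auto
      also have "card (Y2 \<beta> ?S) \<le> card ?S choose 2"
        unfolding Y2_def n_subsets[OF S(2), of 2, symmetric] using S by (intro card_image_le) auto
      finally show ?thesis by simp
    qed
    have "bern ?F p (\<lambda>E. A \<beta> E \<and> A \<beta>' E) \<le>
      (p ^ card (X \<beta>) * (1 - p) ^ card (Y \<beta>)) * (p ^ card (X \<beta>') * (1 - p) ^ card (Y \<beta>')) /
      (p ^ card ?S * (1 - p) ^ (card ?S * (m - 1) + (card ?S choose 2)))"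
      unfolding A_def
      by (rule bern_joint_cylinder[OF finF p Xsub[OF \<beta>] Ysub[OF \<beta>] Xsub[OF \<beta>'] Ysub[OF \<beta>'] XY[OF \<beta>] XY[OF \<beta>'] x y])
    then show ?thesis unfolding cX[OF \<beta>] cX[OF \<beta>'] cY[OF \<beta>] cY[OF \<beta>']
      by (simp add: \<pi>_def W_def power2_eq_square)
  qed
  have cB: "card ({..<LB} \<times> {..<m}) = LB * m" by simp
  have card\<Omega>: "card \<Omega> = (LB * m) ^ k" unfolding \<Omega>_def by (simp add: card_PiE)
  have M0: "real (LB * m) > 0" using LB m by simp
  have RW: "(\<Sum>l\<le>k. real (k choose l) * real (LB * m) ^ (k - l) * W l) = R * real (card \<Omega>)"
    unfolding R_def sum_distrib_right card\<Omega>
  proof (intro sum.cong refl)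
    fix l assume "l \<in> {..k}"
    then have l: "l \<le> k" by simp
    have M: "real (LB * m) ^ (k - l) = real (LB * m) ^ k / real (LB * m) ^ l"
      using LB m l by (intro power_diff) auto
    have P: "(1 / (real (LB * m) * (p * (1 - p) ^ (m - 1)))) ^ l =
        1 / (real (LB * m) ^ l * (p ^ l * (1 - p) ^ (l * (m - 1))))"
      unfolding mult.commute[of l] power_mult power_divide power_mult_distrib by simp
    show "real (k choose l) * real (LB * m) ^ (k - l) * W l =
      real (k choose l) * (1 / (real (LB * m) * (p * (1 - p) ^ (m - 1)))) ^ l / (1 - p) ^ (l choose 2) * real ((LB * m) ^ k)"
      unfolding M W_def of_nat_power P power_add by simp
  qed
  have "1 \<le> R * bern ?F p (\<lambda>E. \<exists>\<beta>\<in>\<Omega>. A \<beta> E)"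
  proof (rule bern_second_moment[where \<pi> = \<pi>])
    show "finite \<Omega>" unfolding \<Omega>_def by (intro finite_PiE) auto
    show "\<Omega> \<noteq> {}" using card\<Omega> LB m by (metis card.empty mult_eq_0_iff not_one_le_zero power_not_zero)
    show "0 < \<pi>" using p by (simp add: \<pi>_def)
    fix \<beta> assume \<beta>: "\<beta> \<in> \<Omega>"
    have "(\<Sum>\<beta>'\<in>\<Omega>. bern ?F p (\<lambda>E. A \<beta> E \<and> A \<beta>' E)) \<le> (\<Sum>\<beta>'\<in>\<Omega>. \<pi>\<^sup>2 * W (card (agree \<beta> \<beta>')))"
      using joint[OF \<beta>] by (intro sum_mono) auto
    also have "\<dots> = \<pi>\<^sup>2 * (\<Sum>\<beta>'\<in>\<Omega>. W (card (agree \<beta> \<beta>')))" by (simp add: sum_distrib_left)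
    also have "\<dots> \<le> \<pi>\<^sup>2 * (\<Sum>l\<le>k. real (k choose l) * real (LB * m) ^ (k - l) * W l)"
      using sum_over_agreement[of "{..<LB} \<times> {..<m}" \<beta> k W] \<beta> W0
      by (intro mult_left_mono) (simp_all add: \<Omega>_def agree_def cB)
    finally show "(\<Sum>\<beta>'\<in>\<Omega>. bern ?F p (\<lambda>E. A \<beta> E \<and> A \<beta>' E)) \<le> R * real (card \<Omega>) * \<pi>\<^sup>2"
      unfolding RW by (simp add: mult.commute)
  qed (use p first in auto)
  also have "\<dots> \<le> R * bern ?F p (has_pendants c m N n k)"
  proof (intro mult_left_mono bern_mono)
    show "0 \<le> R" unfolding R_def using p by (intro sum_nonneg) auto
    fix E assume "\<exists>\<beta>\<in>\<Omega>. A \<beta> E"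
    then obtain \<beta> where \<beta>: "\<beta> \<in> \<Omega>" "X \<beta> \<subseteq> E" "Y \<beta> \<inter> E = {}" by (auto simp: A_def)
    show "has_pendants c m N n k E"
      unfolding has_pendants_def
    proof (rule exI[of _ "b \<beta>"], rule exI[of _ "\<lambda>i. snd (\<beta> i)"], intro conjI allI impI)
      show "inj_on (b \<beta>) {..<k}" by (rule b_inj[OF \<beta>(1)])
      fix i assume i: "i < k"
      show "N \<le> b \<beta> i" "b \<beta> i < n" "snd (\<beta> i) < m" using b_ge b_lt \<Omega>D \<beta> i by auto
      show "({b \<beta> i, c j} \<in> E) = (j = snd (\<beta> i))" if "j < m" for j
      proof (cases "j = snd (\<beta> i)")
        case True
        then show ?thesis using \<beta>(2) i by (auto simp: X_def)
      next
        case False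
        then have "{b \<beta> i, c j} \<in> Y \<beta>" using i that
          by (auto simp: Y_def Y1_def intro!: image_eqI[of _ _ "(i, j)"])
        then show ?thesis using \<beta>(3) False by blast
      qed
      show "{b \<beta> i, b \<beta> i'} \<notin> E" if "i' < k" "i \<noteq> i'" for i'
      proof -
        have "{b \<beta> i, b \<beta> i'} \<in> Y2 \<beta> {..<k}" unfolding Y2_def using that i
          by (intro image_eqI[of _ _ "{i, i'}"]) auto
        then show ?thesis using \<beta>(3) by (auto simp: Y_def)
      qed
    qed
  qed (use p in auto)
  finally show ?thesis .
qed

section \<open>From a cycle with pendants to the event in the definition of u\<close>

lemma induced_edges_doubleton: "x \<in> W \<Longrightarrow> y \<in> W \<Longrightarrow> {x, y} \<in> induced_edges E W \<longleftrightarrow> {x, y} \<in> E"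
  by (simp add: induced_edges_def)

text \<open>The cycle lies in the first \<open>N\<close> vertices and the pendants outside them, so
  the bound \<open>b\<close> for the second stage holds for every cycle found in the first. The
  graph is connected, hence \<open>conn\<close> can be arbitrary.\<close>

lemma good_event_prob:
  assumes p: "0 < p" "p < 1" and m: "odd m" "3 \<le> m" and LB: "1 \<le> LB" and n: "N + k * LB \<le> n"
    and a: "a \<le> prob_G N p (has_induced (cyc_adj m) m N)" "0 \<le> b"
    and R: "(\<Sum>l\<le>k. real (k choose l) * (1 / (real (LB * m) * (p * (1 - p) ^ (m - 1)))) ^ l / (1 - p) ^ (l choose 2)) * b \<le> 1"
  shows "a * b \<le> prob_G n p (good_event TYPE(real^2) conn n (m + k))"
proof (rule prob_G_extend[OF _ _ _ a])
  show "N \<le> n" using n by simp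
next
  fix E assume E: "E \<subseteq> all_edges N" and "has_induced (cyc_adj m) m N E"
  then obtain c where c: "inj_on c {..<m}" "\<And>j. j < m \<Longrightarrow> c j < N"
    "\<And>i j. i < j \<Longrightarrow> j < m \<Longrightarrow> {c i, c j} \<in> E \<longleftrightarrow> cyc_adj m i j"
    unfolding has_induced_def by blast
  let ?F = "all_edges n - all_edges N"
  define R where "R = (\<Sum>l\<le>k. real (k choose l) * (1 / (real (LB * m) * (p * (1 - p) ^ (m - 1)))) ^ l / (1 - p) ^ (l choose 2))"
  have one: "1 \<le> R * bern ?F p (has_pendants c m N n k)"
    unfolding R_def using m by (intro has_pendants_prob p c LB n) auto
  have "R \<ge> 0" unfolding R_def using p by (intro sum_nonneg) auto
  moreover have "R \<noteq> 0" using one by auto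
  ultimately have R0: "R > 0" by simp
  have "R * b \<le> R * bern ?F p (has_pendants c m N n k)" using one R[folded R_def] by linarith
  then have "b \<le> bern ?F p (has_pendants c m N n k)" using R0 by simp
  also have "\<dots> \<le> bern ?F p (\<lambda>E'. good_event TYPE(real^2) conn n (m + k) (E \<union> E'))"
  proof (rule bern_mono)
    fix E' assume E': "E' \<subseteq> ?F" and "has_pendants c m N n k E'"
    then obtain b a where b0: "inj_on b {..<k}" and b1: "\<forall>i<k. N \<le> b i \<and> b i < n \<and> a i < m"
      and b2: "\<forall>i<k. \<forall>j<m. {b i, c j} \<in> E' \<longleftrightarrow> j = a i"
      and b3: "\<forall>i<k. \<forall>i'<k. i \<noteq> i' \<longrightarrow> {b i, b i'} \<notin> E'"
      unfolding has_pendants_def by (elim exE conjE)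
    have b: "inj_on b {..<k}" "\<And>i. i < k \<Longrightarrow> N \<le> b i" "\<And>i. i < k \<Longrightarrow> b i < n" "\<And>i. i < k \<Longrightarrow> a i < m"
      "\<And>i j. i < k \<Longrightarrow> j < m \<Longrightarrow> {b i, c j} \<in> E' \<longleftrightarrow> j = a i"
      "\<And>i i'. i < k \<Longrightarrow> i' < k \<Longrightarrow> i \<noteq> i' \<Longrightarrow> {b i, b i'} \<notin> E'"
      using b0 b1 b2 b3 by simp_all
    define I where "I = b ` {..<k}"
    define W where "W = c ` {..<m} \<union> I"
    define F where "F = induced_edges (E \<union> E') W"
    define \<alpha> where "\<alpha> v = a (inv_into {..<k} b v)" for v
    have \<alpha>b: "\<alpha> (b i) = a i" if "i < k" for i using b(1) that by (simp add: \<alpha>_def)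
    have oldE': "{x, y} \<notin> E'" if "x < N" "y < N" for x y
      using E' that doubleton_in_all_edges_iff[of x y N] doubleton_in_all_edges_iff[of x y n] by auto
    have newE: "{x, y} \<notin> E" if "N \<le> x" for x y
      using E that doubleton_in_all_edges_iff[of x y N] by auto
    have IK: "I \<inter> c ` {..<m} = {}"
    proof -
      have "b i \<noteq> c j" if "i < k" "j < m" for i j using b(2)[OF that(1)] c(2)[OF that(2)] by simp
      then show ?thesis by (auto simp: I_def)
    qed
    have prem: "{c i, c j} \<in> F \<longleftrightarrow> cyc_adj m i j" if "i < j" "j < m" for i j
    proof -
      have "{c i, c j} \<in> F \<longleftrightarrow> {c i, c j} \<in> E \<union> E'"
        unfolding F_def using that by (intro induced_edges_doubleton) (auto simp: W_def)
      then show ?thesis using oldE'[of "c i" "c j"] c(2)[of i] c(2)[of j] c(3)[OF that] that by auto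
    qed
    have att: "{v, c j} \<in> F \<longleftrightarrow> j = \<alpha> v" if v: "v \<in> I" and j: "j < m" for v j
    proof -
      obtain i where i: "i < k" "v = b i" using v by (auto simp: I_def)
      have "{v, c j} \<in> F \<longleftrightarrow> {v, c j} \<in> E \<union> E'"
        unfolding F_def using v j by (intro induced_edges_doubleton) (auto simp: W_def)
      then show ?thesis using i newE[of v "c j"] b(2)[OF i(1)] b(5)[OF i(1) j] \<alpha>b[OF i(1)] by auto
    qed
    have ind: "{u, v} \<notin> F" if uv: "u \<in> I" "v \<in> I" "u \<noteq> v" for u v
    proof -
      obtain i i' where i: "i < k" "u = b i" "i' < k" "v = b i'" using uv by (auto simp: I_def)
      have "{u, v} \<in> F \<longleftrightarrow> {u, v} \<in> E \<union> E'"
        unfolding F_def using uv by (intro induced_edges_doubleton) (auto simp: W_def)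
      then show ?thesis using i newE[of u v] b(2)[OF i(1)] b(6)[OF i(1,3)] uv by auto
    qed
    have fI: "finite I" by (simp add: I_def)
    have \<alpha>m: "\<alpha> v < m" if "v \<in> I" for v using that \<alpha>b b(4) by (auto simp: I_def)
    note g = odd_cycle_pendants[OF m c(1) prem fI IK \<alpha>m att ind, folded W_def]
    have cN: "c j < n" if "j < m" for j using c(2)[OF that] n by linarith
    have "card W = m + k" unfolding W_def using IK fI c(1) b(1)
      by (subst card_Un_disjoint) (auto simp: I_def card_image)
    moreover have "W \<subseteq> {..<n}" using cN b(3) by (auto simp: W_def I_def)
    ultimately show "good_event TYPE(real^2) conn n (m + k) (E \<union> E')"
      unfolding good_event_def using g by (intro exI[of _ W]) (simp add: F_def)
  qed (use p in auto)
  finally show "b \<le> bern ?F p (\<lambda>E'. good_event TYPE(real^2) conn n (m + k) (E \<union> E'))" .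
qed (use p in auto)

text \<open>The maximum is taken over a finite set because no \<open>W\<close> inside
  \<open>{..<n}\<close> has more than \<open>n\<close> elements.\<close>

lemma u_gen_ge:
  fixes T :: "'a::euclidean_space itself"
  assumes k: "0 < k" and pr: "prob_G n p (good_event T conn n k) > 1/2"
  shows "k \<le> u_gen T conn n p"
proof -
  let ?S = "{k. 0 < k \<and> prob_G n p (good_event T conn n k) > 1/2}"
  have "k' \<le> n" if "k' \<in> ?S" for k'
  proof (rule ccontr)
    assume "\<not> k' \<le> n"
    then have "\<not> good_event T conn n k' E" for E
      unfolding good_event_def using card_mono[of "{..<n}"] by fastforce
    then have "prob_G n p (good_event T conn n k') = 0" by (simp add: prob_G_def)
    then show False using that by simp
  qed
  then have "finite ?S" by (intro finite_subset[of ?S "{..n}"]) auto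
  moreover have "k \<in> ?S" using k pr by simp
  ultimately show ?thesis unfolding u_gen_def Let_def using Max_ge by auto
qed

subsection \<open>Asymptotics\<close>

lemma one_minus_power_le_exp:
  fixes y :: real
  assumes "0 \<le> y" "y \<le> 1"
  shows "(1 - y) ^ L \<le> exp (- (y * real L))"
proof -
  have "(1 - y) ^ L \<le> exp (- y) ^ L" using assms exp_ge_add_one_self[of "- y"] by (intro power_mono) auto
  then show ?thesis by (simp add: exp_of_nat_mult[symmetric] mult.commute)
qed

text \<open>Small overlaps are controlled by the trivial bound k^l on the binomial coefficient,
  overlaps that are a positive fraction of k by the bound 2^k.\<close>

lemma overlap_term_le:
  fixes p g \<tau> z :: real
  assumes p: "0 < p" "p \<le> 1/2" and g: "0 \<le> g" and \<tau>: "0 < \<tau>" and l: "l \<le> k"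
    and z1: "real k * g * exp ((p + 2 * p\<^sup>2) * \<tau> * real k / 2) \<le> z"
    and z2: "2 powr (1 / \<tau>) * g * exp ((p + 2 * p\<^sup>2) * real k / 2) \<le> z"
  shows "real (k choose l) * g ^ l / (1 - p) ^ (l choose 2) \<le> z ^ l"
proof -
  define q where "q = p + 2 * p\<^sup>2"
  have q: "0 \<le> q" using p by (simp add: q_def)
  \<comment> \<open>From ln(1 - p) \<ge> - p - 2 p^2. The quadratic term contributes only about p^2
    k, which tends to 0 for the \<open>k\<close> used later.\<close>
  have "- q \<le> ln (1 - p)" using ln_one_minus_pos_lower_bound[of p] p by (simp add: q_def)
  then have "exp (- q) \<le> 1 - p" using p by (simp add: ln_ge_iff)
  then have "exp (- q) ^ (l choose 2) \<le> (1 - p) ^ (l choose 2)" by (intro power_mono) auto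
  then have "1 / (1 - p) ^ (l choose 2) \<le> 1 / exp (- q) ^ (l choose 2)" by (intro divide_left_mono) (use p in auto)
  also have "1 / exp (- q) ^ (l choose 2) = exp (q * real (l choose 2))"
    by (simp add: exp_of_nat_mult[symmetric] exp_minus field_simps)
  finally have e: "1 / (1 - p) ^ (l choose 2) \<le> exp (q * real (l choose 2))" .
  have ch: "real (l choose 2) \<le> real l * (real l / 2)"
  proof -
    have "2 * (l choose 2) \<le> l * (l - 1)" unfolding choose_two by (rule times_div_less_eq_dividend)
    also have "\<dots> \<le> l * l" by simp
    finally have "2 * (l choose 2) \<le> l * l" .
    then have "real (2 * (l choose 2)) \<le> real (l * l)" by (rule of_nat_mono)
    then show ?thesis by simp
  qed
  \<comment> \<open>With \<open>B\<close> in place of one of the two factors l, the exponent becomes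
    linear in l and the whole term an l-th power. Both regimes are instances: \<open>A = k\<close>,
    \<open>B = \<tau> * k\<close> and \<open>A = 2 powr (1 / \<tau>)\<close>,
    \<open>B = k\<close>.\<close>
  have key: "real (k choose l) * g ^ l / (1 - p) ^ (l choose 2) \<le> z ^ l"
    if A: "real (k choose l) \<le> A ^ l" "0 \<le> A" and B: "real l \<le> B" and z: "A * g * exp (q * B / 2) \<le> z" for A B
  proof -
    have "q * real (l choose 2) \<le> q * (real l * (B / 2))"
      using ch B by (intro mult_left_mono q order_trans[OF ch] ) auto
    then have "exp (q * real (l choose 2)) \<le> exp (real l * (q * B / 2))" by (simp add: mult_ac)
    also have "\<dots> = exp (q * B / 2) ^ l" by (rule exp_of_nat_mult)
    finally have "1 / (1 - p) ^ (l choose 2) \<le> exp (q * B / 2) ^ l" using e by simp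
    then have "(real (k choose l) * g ^ l) * (1 / (1 - p) ^ (l choose 2)) \<le> (A ^ l * g ^ l) * exp (q * B / 2) ^ l"
      using A g p by (intro mult_mono) auto
    also have "\<dots> = (A * g * exp (q * B / 2)) ^ l" by (simp add: power_mult_distrib)
    also have "\<dots> \<le> z ^ l" using A g z by (intro power_mono) auto
    finally show ?thesis by simp
  qed
  show ?thesis
  proof (cases "real l \<le> \<tau> * real k")
    case True
    have "real (k choose l) \<le> real k ^ l"
      using binomial_le_pow[OF l] by (metis of_nat_mono of_nat_power)
    then show ?thesis using key[of "real k" "\<tau> * real k"] True z1 by (simp add: q_def mult.assoc)
  next
    case False
    have "real (k choose l) \<le> real (2 ^ k)" using binomial_le_pow2[of k l] by (rule of_nat_mono)
    also have "\<dots> = 2 powr real k" by (simp add: powr_realpow)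
    also have "\<dots> \<le> 2 powr (real l / \<tau>)" using False \<tau> by (intro powr_mono) (auto simp: field_simps)
    also have "\<dots> = (2 powr (1 / \<tau>)) ^ l" by (simp add: powr_powr powr_realpow[symmetric])
    finally show ?thesis using key[of "2 powr (1 / \<tau>)" "real k"] l z2 by (simp add: q_def)
  qed
qed

text \<open>The overlap terms are dominated by a geometric series of ratio \<open>z\<close>, whose
  sum is at most 1 / (1 - z).\<close>

lemma overlap_sum_le:
  fixes p g \<tau> z :: real
  assumes "0 < p" "p \<le> 1/2" "0 \<le> g" "0 < \<tau>"
    and "real k * g * exp ((p + 2 * p\<^sup>2) * \<tau> * real k / 2) \<le> z"
    and "2 powr (1 / \<tau>) * g * exp ((p + 2 * p\<^sup>2) * real k / 2) \<le> z"
    and z: "z < 1"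
  shows "(\<Sum>l\<le>k. real (k choose l) * g ^ l / (1 - p) ^ (l choose 2)) * (1 - z) \<le> 1"
proof -
  have "0 \<le> 2 powr (1 / \<tau>) * g * exp ((p + 2 * p\<^sup>2) * real k / 2)" using assms by simp
  then have z0: "0 \<le> z" using assms(6) by linarith
  have "(\<Sum>l\<le>k. real (k choose l) * g ^ l / (1 - p) ^ (l choose 2)) * (1 - z) \<le> (\<Sum>l\<le>k. z ^ l) * (1 - z)"
    using z by (intro mult_right_mono sum_mono overlap_term_le[OF assms(1-4) _ assms(5,6)]) auto
  also have "\<dots> = 1 - z ^ Suc k" using sum_gp_basic[of z k] by (simp add: mult.commute)
  also have "\<dots> \<le> 1" using z0 by simp
  finally show ?thesis .
qed

text \<open>All that is needed of large \<open>n\<close> is isolated in inequalities in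
  \<open>x\<close>: \<open>H1\<close> keeps p, r p and p ln n small, \<open>H2\<close> serves the
  path, \<open>H3\<close> the closing vertex, \<open>H4\<close> makes the pendant blocks nonempty,
  and \<open>H5\<close> and \<open>H6\<close> control small and large overlaps.\<close>

lemma u_gen_lower_bound:
  fixes p \<alpha> \<delta> \<tau> C :: real and n :: nat
  defines "x \<equiv> real n" and "\<kappa> \<equiv> 2 - 2 * \<alpha> - 4 * \<delta>"
  assumes \<alpha>: "0 < \<alpha>" "\<alpha> < 1/2" and \<delta>: "0 < \<delta>" "\<delta> < \<alpha>" "4 * \<delta> \<le> 1 - 2 * \<alpha>" and \<tau>: "0 < \<tau>"
    and pC: "1 < p * x powr \<alpha>" "p * x powr \<alpha> < C"
    and x8: "8 \<le> x"  and lnx: "1 \<le> ln x"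
    and H1: "C * x powr (-\<alpha>) \<le> 1/2" "8 * C * x powr (-\<delta>) \<le> 1" "4 * C * x powr (-\<alpha>) * ln x \<le> 1"
    and H2: "4 * x powr (\<alpha> - \<delta>) * exp (- ((x powr (-\<alpha>) / 2) * (x powr (1 - \<alpha> + \<delta>) / 16 - 1))) \<le> 1/20"
      "32 * x powr (\<alpha> - \<delta>) \<le> x"
    and H3: "exp (- (x powr (1 - 2 * \<alpha>) / 16)) \<le> 1/20"
    and H4: "12 * x powr \<alpha> * ln x \<le> x"
    and H5: "8 * (3 * x powr \<alpha> * ln x)\<^sup>2 * x powr (\<delta> - 1) * exp (\<tau> * (2 * ln x + 1)) \<le> 1/20"
    and H6: "2 powr (1 / \<tau>) * (8 * (3 * x powr \<alpha> * ln x) * x powr (\<delta> - 1)) * exp ((1 - \<alpha> - 2 * \<delta>) * ln x + 2) \<le> 1/20"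
  shows "\<kappa> * ln x / p \<le> real (u_gen TYPE(real^2) conn n p)"
proof -
  have x0: "x > 0" using x8 by simp
  have xp: "x powr \<alpha> * x powr (-\<alpha>) = 1" using x0 by (simp add: powr_add[symmetric])
  have plo: "x powr (-\<alpha>) \<le> p"
  proof -
    have "1 * x powr (-\<alpha>) \<le> p * x powr \<alpha> * x powr (-\<alpha>)" using pC by (intro mult_right_mono) auto
    then show ?thesis using xp by (simp add: mult.assoc)
  qed
  have phi: "p \<le> C * x powr (-\<alpha>)"
  proof -
    have "p * x powr \<alpha> * x powr (-\<alpha>) \<le> C * x powr (-\<alpha>)" using pC by (intro mult_right_mono) auto
    then show ?thesis using xp by (simp add: mult.assoc)
  qed
  have p0: "0 < p" using plo x0 powr_gt_zero[of x "-\<alpha>"] by linarith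
  have p2: "p \<le> 1/2" using phi H1(1) by linarith
  have \<kappa>: "1 \<le> \<kappa>" "\<kappa> \<le> 2" using \<alpha> \<delta> by (auto simp: \<kappa>_def)
  have xad: "1 \<le> x powr (\<alpha> - \<delta>)" using x8 \<delta> by (intro ge_one_powr_ge_zero) auto

  \<comment> \<open>The first half of the vertices is for the cycle: 2 r blocks of length
    \<open>L\<close> take at most n / 4 of them and leave at least n / 8 for the closing vertex. The
    k blocks of length \<open>LB\<close> fit into the other half.\<close>
  define r where "r = nat \<lceil>x powr (\<alpha> - \<delta>)\<rceil>"
  define m where "m = 2 * r + 1"
  define k where "k = nat \<lceil>\<kappa> * ln x / p\<rceil>"
  define L where "L = n div (8 * r)"
  define N where "N = n div 2"
  define LB where "LB = n div (2 * k)"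

  have rlo: "x powr (\<alpha> - \<delta>) \<le> real r" using xad by (simp add: r_def real_nat_ceiling_ge)
  have rhi: "real r \<le> 2 * x powr (\<alpha> - \<delta>)"
  proof -
    have "real r < x powr (\<alpha> - \<delta>) + 1" using xad unfolding r_def by linarith
    then show ?thesis using xad by linarith
  qed
  have r1: "1 \<le> r" using rlo xad by linarith
  have klo: "\<kappa> * ln x / p \<le> real k" by (simp add: k_def real_nat_ceiling_ge)
  have kp0: "0 < \<kappa> * ln x / p" using \<kappa> lnx p0 by simp
  have khi: "real k \<le> \<kappa> * ln x / p + 1" using kp0 unfolding k_def by linarith
  have k1: "1 \<le> k" using klo kp0 by linarith
  have kK: "real k \<le> 3 * x powr \<alpha> * ln x"
  proof -
    have ip: "1 / p \<le> x powr \<alpha>"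
      using pC p0 by (simp add: field_simps)
    have "\<kappa> * ln x / p = (\<kappa> * ln x) * (1 / p)" by simp
    also have "\<dots> \<le> (2 * ln x) * x powr \<alpha>" using \<kappa> lnx ip p0 by (intro mult_mono) auto
    finally have 1: "\<kappa> * ln x / p \<le> 2 * x powr \<alpha> * ln x" by (simp add: mult_ac)
    have "1 \<le> x powr \<alpha>" using x8 \<alpha> by (intro ge_one_powr_ge_zero) auto
    then have "1 * 1 \<le> x powr \<alpha> * ln x" using lnx by (intro mult_mono) auto
    then show ?thesis using khi 1 by linarith
  qed

  have h: "1/2 \<le> (1 - p) ^ (2 * r)"
  proof -
    have "real r * p \<le> (2 * x powr (\<alpha> - \<delta>)) * (C * x powr (-\<alpha>))"
      using rhi phi p0 by (intro mult_mono) auto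
    also have "\<dots> = 2 * C * x powr (-\<delta>)"
      using x0 by (simp add: powr_add[symmetric] mult_ac)
    finally have rp: "real r * p \<le> 1/4" using H1(2) by linarith
    have "1 + real (2 * r) * (- p) \<le> (1 + (- p)) ^ (2 * r)" using p2 by (intro Bernoulli_inequality) auto
    then show ?thesis using rp by simp
  qed

  have cycle: "(19/20) * (19/20) \<le> prob_G N p (has_induced (cyc_adj m) m N)"
  proof -
    have r8: "8 * r \<le> n" using rhi H2(2) unfolding x_def by linarith
    have L1: "1 \<le> L" unfolding L_def using r8 r1 by (simp add: div_greater_zero_iff Suc_le_eq)
    have rL: "8 * r * L \<le> n" unfolding L_def by (rule times_div_less_eq_dividend)
    have Llo: "x powr (1 - \<alpha> + \<delta>) / 16 - 1 \<le> real L"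
    proof -
      have "x < real (8 * r) * (real L + 1)"
      proof -
        have "n < 8 * r * (L + 1)" unfolding L_def using r1 dividend_less_times_div[of "8 * r" n] by simp
        then have "real n < real (8 * r * (L + 1))" by (rule of_nat_less_iff[THEN iffD2])
        then show ?thesis by (simp add: x_def distrib_left)
      qed
      also have "\<dots> \<le> (16 * x powr (\<alpha> - \<delta>)) * (real L + 1)" using rhi by (intro mult_right_mono) auto
      finally have "x * x powr (-(\<alpha> - \<delta>)) \<le> (16 * x powr (\<alpha> - \<delta>)) * (real L + 1) * x powr (-(\<alpha> - \<delta>))"
        by (intro mult_right_mono) auto
      also have "\<dots> = 16 * (real L + 1) * (x powr (\<alpha> - \<delta>) * x powr (-(\<alpha> - \<delta>)))" by (simp only: mult_ac)
      also have "x powr (\<alpha> - \<delta>) * x powr (-(\<alpha> - \<delta>)) = 1" using x0 by (simp add: powr_add[symmetric])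
      also have "x * x powr (-(\<alpha> - \<delta>)) = x powr (1 - \<alpha> + \<delta>)"
        using x0 powr_mult_base[of x "-(\<alpha> - \<delta>)"] by (simp add: algebra_simps)
      finally show ?thesis by simp
    qed
    \<comment> \<open>Here p L is at least of order n^(1 - 2 \<alpha> + \<delta>), so the
      exponential outweighs the polynomial number of rounds.\<close>
    have e1: "real (2 * r) * (1 - p * (1/2)) ^ L \<le> 1/20"
    proof -
      have "(1 - p * (1/2)) ^ L \<le> exp (- (p * (1/2) * real L))"
        using p0 p2 by (intro one_minus_power_le_exp) auto
      also have "\<dots> \<le> exp (- ((x powr (-\<alpha>) / 2) * (x powr (1 - \<alpha> + \<delta>) / 16 - 1)))"
      proof -
        have "(x powr (-\<alpha>) / 2) * (x powr (1 - \<alpha> + \<delta>) / 16 - 1) \<le> (x powr (-\<alpha>) / 2) * real L"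
          using Llo by (intro mult_left_mono) auto
        also have "\<dots> \<le> p * (1/2) * real L" using plo by (intro mult_right_mono) auto
        finally show ?thesis by simp
      qed
      finally have "real (2 * r) * (1 - p * (1/2)) ^ L \<le> (4 * x powr (\<alpha> - \<delta>)) *
          exp (- ((x powr (-\<alpha>) / 2) * (x powr (1 - \<alpha> + \<delta>) / 16 - 1)))"
        using rhi p2 by (intro mult_mono) auto
      then show ?thesis using H2(1) by linarith
    qed
    \<comment> \<open>The expected number of closing vertices is at least of order n p^2, that is
      n^(1 - 2 \<alpha>).\<close>
    have e2: "(1 - p\<^sup>2 * (1/2)) ^ (N - 2 * r * L) \<le> 1/20"
    proof -
      have "2 * (r * (L * 4)) \<le> n" using rL by (simp add: mult_ac)
      then have "n \<le> 8 * (N - 2 * r * L)"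
        unfolding N_def using x8 by (simp add: x_def algebra_simps)
      then have Nlo: "x / 8 \<le> real (N - 2 * r * L)" unfolding x_def by linarith
      have psq: "p\<^sup>2 \<le> 1" using p0 p2 by (simp add: power_le_one)
      have "(1 - p\<^sup>2 * (1/2)) ^ (N - 2 * r * L) \<le> exp (- (p\<^sup>2 * (1/2) * real (N - 2 * r * L)))"
        using psq by (intro one_minus_power_le_exp) auto
      also have "\<dots> \<le> exp (- (x powr (1 - 2 * \<alpha>) / 16))"
      proof -
        have "x powr (1 - 2 * \<alpha>) / 16 = (x powr (-\<alpha>))\<^sup>2 * (1/2) * (x / 8)"
        proof -
          have "x powr (1 - 2 * \<alpha>) = x * x powr (-2 * \<alpha>)" using powr_mult_base[of x "-2 * \<alpha>"] x0 by simp
          also have "x powr (-2 * \<alpha>) = (x powr (-\<alpha>))\<^sup>2"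
            using x0 by (simp add: power2_eq_square powr_add[symmetric])
          finally show ?thesis by simp
        qed
        also have "\<dots> \<le> p\<^sup>2 * (1/2) * real (N - 2 * r * L)"
          by (intro mult_mono power_mono plo Nlo) (use x0 in auto)
        finally show ?thesis by simp
      qed
      finally show ?thesis using H3 by linarith
    qed
    have "(1 - real (2 * r) * (1 - p * (1/2)) ^ L) * (1 - (1 - p\<^sup>2 * (1/2)) ^ (N - 2 * r * L)) \<le>
        prob_G N p (has_induced (cyc_adj (2 * r + 1)) (2 * r + 1) N)"
    proof (rule induced_odd_cycle_prob)
      have "2 * (2 * r * L) \<le> n" using rL by linarith
      then show "2 * r * L \<le> N" unfolding N_def by linarith
    qed (use p0 p2 r1 L1 h e1 in auto)
    moreover have "(19/20) * (19/20) \<le>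
        (1 - real (2 * r) * (1 - p * (1/2)) ^ L) * (1 - (1 - p\<^sup>2 * (1/2)) ^ (N - 2 * r * L))"
      using e1 e2 by (intro mult_mono) auto
    ultimately show ?thesis unfolding m_def by linarith
  qed

  define g where "g = 1 / (real (LB * m) * (p * (1 - p) ^ (m - 1)))"
  have k4: "4 * k \<le> n" using kK H4 unfolding x_def by linarith
  have LBlo: "x / (4 * real k) \<le> real LB" and LB1: "1 \<le> LB"
  proof -
    show "1 \<le> LB" unfolding LB_def using k4 k1 by (simp add: div_greater_zero_iff Suc_le_eq)
    then have "2 * k * 1 \<le> 2 * k * LB" by (rule mult_le_mono2)
    moreover have "n < 2 * k + 2 * k * LB"
      using dividend_less_times_div[of "2 * k" n] k1 unfolding LB_def by simp
    ultimately have "n < 2 * k * (2 * LB)" by linarith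
    then have "real n < real (2 * k * (2 * LB))" by (rule of_nat_less_iff[THEN iffD2])
    then show "x / (4 * real k) \<le> real LB" using k1 by (simp add: x_def field_simps)
  qed
  have mp: "x powr (-\<delta>) \<le> real m * p"
  proof -
    have "x powr (-\<delta>) = x powr (\<alpha> - \<delta>) * x powr (-\<alpha>)" using x0 by (simp add: powr_add[symmetric])
    also have "\<dots> \<le> real m * p" using rlo plo by (intro mult_mono) (auto simp: m_def)
    finally show ?thesis .
  qed
  have g0: "0 \<le> g" using p0 p2 by (simp add: g_def)
  \<comment> \<open>A block has at least n / (4 k) vertices, m p is at least n^(- \<delta>), and
    avoiding the rest of the cycle costs at most a factor 2.\<close>
  have glo: "g \<le> 8 * real k * x powr (\<delta> - 1)"
  proof -
    have "x / (4 * real k) * x powr (-\<delta>) * (1/2) \<le> real LB * (real m * p) * (1 - p) ^ (m - 1)"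
      using LBlo mp h x0 p0 by (intro mult_mono) (auto simp: m_def)
    moreover have "0 < x / (4 * real k) * x powr (-\<delta>) * (1/2)" using x0 k1 by simp
    ultimately have "1 / (real LB * (real m * p) * (1 - p) ^ (m - 1)) \<le> 1 / (x / (4 * real k) * x powr (-\<delta>) * (1/2))"
      by (intro frac_le) auto
    then have "g \<le> 1 / (x / (4 * real k) * x powr (-\<delta>) * (1/2))"
      by (simp only: g_def of_nat_mult mult.assoc)
    also have "\<dots> = 8 * real k * (1 / (x * x powr (-\<delta>)))" using x0 k1 by (simp add: field_simps)
    also have "1 / (x * x powr (-\<delta>)) = x powr (\<delta> - 1)"
      using x0 powr_mult_base[of x "-\<delta>"] powr_minus_divide[of x "1 - \<delta>"] by simp
    finally show ?thesis .
  qed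
  have pk: "p * real k \<le> \<kappa> * ln x + p" using khi p0 by (simp add: field_simps)
  \<comment> \<open>Small overlaps tolerate the crude bound p + 2 p^2 \<le> 2 p, because \<tau> can
    still be chosen to absorb it.\<close>
  have z1: "real k * g * exp ((p + 2 * p\<^sup>2) * \<tau> * real k / 2) \<le> 1/20"
  proof -
    have "(p + 2 * p\<^sup>2) * real k = (1 + 2 * p) * (p * real k)" by (simp add: power2_eq_square algebra_simps)
    also have "\<dots> \<le> 2 * (2 * ln x + 1)"
    proof (rule mult_mono)
      have "\<kappa> * ln x \<le> 2 * ln x" using \<kappa> lnx by (intro mult_right_mono) auto
      then show "p * real k \<le> 2 * ln x + 1" using pk p2 by linarith
    qed (use p0 p2 in auto)
    finally have "\<tau> * ((p + 2 * p\<^sup>2) * real k) \<le> \<tau> * (2 * (2 * ln x + 1))" using \<tau> by (intro mult_left_mono) auto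
    then have E: "exp ((p + 2 * p\<^sup>2) * \<tau> * real k / 2) \<le> exp (\<tau> * (2 * ln x + 1))" by (simp add: mult_ac)
    have "real k * g \<le> real k * (8 * real k * x powr (\<delta> - 1))" using glo by (intro mult_left_mono) auto
    also have "\<dots> = 8 * (real k)\<^sup>2 * x powr (\<delta> - 1)" by (simp add: power2_eq_square)
    also have "\<dots> \<le> 8 * (3 * x powr \<alpha> * ln x)\<^sup>2 * x powr (\<delta> - 1)"
      using kK by (intro mult_right_mono mult_left_mono power_mono) auto
    finally have "real k * g * exp ((p + 2 * p\<^sup>2) * \<tau> * real k / 2) \<le>
        8 * (3 * x powr \<alpha> * ln x)\<^sup>2 * x powr (\<delta> - 1) * exp (\<tau> * (2 * ln x + 1))"
      using g0 by (intro mult_mono[OF _ E]) auto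
    then show ?thesis using H5 by linarith
  qed
  \<comment> \<open>Here the leading constant matters: half of \<kappa> ln n must appear exactly,
    and the summand 2 absorbs the p^2 k term and the rounding of \<open>k\<close>. The powers
    n^\<alpha>, n^(\<delta> - 1) and n^(1 - \<alpha> - 2 \<delta>) multiply to n^(-
    \<delta>).\<close>
  have z2: "2 powr (1 / \<tau>) * g * exp ((p + 2 * p\<^sup>2) * real k / 2) \<le> 1/20"
  proof -
    have "(p + 2 * p\<^sup>2) * real k = (1 + 2 * p) * (p * real k)" by (simp add: power2_eq_square algebra_simps)
    also have "\<dots> \<le> (1 + 2 * p) * (\<kappa> * ln x + p)" using pk p0 by (intro mult_left_mono) auto
    also have "\<dots> = \<kappa> * ln x + 2 * (p * (\<kappa> * ln x)) + p * (1 + 2 * p)" by (simp add: algebra_simps)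
    finally have s: "(p + 2 * p\<^sup>2) * real k \<le> \<kappa> * ln x + 2 * (p * (\<kappa> * ln x)) + p * (1 + 2 * p)" .
    have "p * (\<kappa> * ln x) \<le> (C * x powr (-\<alpha>)) * (2 * ln x)"
      using phi \<kappa> lnx p0 by (intro mult_mono) auto
    moreover have "(C * x powr (-\<alpha>)) * (2 * ln x) \<le> 1/2" using H1(3) by simp
    moreover have "p * (1 + 2 * p) \<le> (1/2) * 2" using p0 p2 by (intro mult_mono) auto
    moreover have "(1 - \<alpha> - 2 * \<delta>) * ln x = \<kappa> * ln x / 2" by (simp add: \<kappa>_def field_simps)
    ultimately have "(p + 2 * p\<^sup>2) * real k / 2 \<le> (1 - \<alpha> - 2 * \<delta>) * ln x + 2"
      using s by linarith
    then have E: "exp ((p + 2 * p\<^sup>2) * real k / 2) \<le> exp ((1 - \<alpha> - 2 * \<delta>) * ln x + 2)" by simp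
    have "g \<le> 8 * real k * x powr (\<delta> - 1)" by (rule glo)
    also have "\<dots> \<le> 8 * (3 * x powr \<alpha> * ln x) * x powr (\<delta> - 1)"
      using kK by (intro mult_right_mono mult_left_mono) auto
    finally have "2 powr (1 / \<tau>) * g * exp ((p + 2 * p\<^sup>2) * real k / 2) \<le>
        2 powr (1 / \<tau>) * (8 * (3 * x powr \<alpha> * ln x) * x powr (\<delta> - 1)) * exp ((1 - \<alpha> - 2 * \<delta>) * ln x + 2)"
      using g0 kK by (intro mult_mono[OF _ E] mult_left_mono) auto
    then show ?thesis using H6 by linarith
  qed
  have R: "(\<Sum>l\<le>k. real (k choose l) * g ^ l / (1 - p) ^ (l choose 2)) * (19/20) \<le> 1"
    using overlap_sum_le[OF p0 p2 g0 \<tau> z1 z2] by simp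
  \<comment> \<open>One factor each for the path, the closing vertex and the pendants; the product
    is above 1/2.\<close>
  have "(19/20) * (19/20) * (19/20) \<le> prob_G n p (good_event TYPE(real^2) conn n (m + k))"
  proof (rule good_event_prob)
    have "2 * k * LB \<le> n" unfolding LB_def by (rule times_div_less_eq_dividend)
    then show "N + k * LB \<le> n" unfolding N_def by linarith
    show "(\<Sum>l\<le>k. real (k choose l) * (1 / (real (LB * m) * (p * (1 - p) ^ (m - 1)))) ^ l / (1 - p) ^ (l choose 2)) * (19/20) \<le> 1"
      using R unfolding g_def .
  qed (use p0 p2 r1 LB1 cycle in \<open>auto simp: m_def\<close>)
  then have "m + k \<le> u_gen TYPE(real^2) conn n p"
    by (intro u_gen_ge) (auto simp: m_def)
  then have "real k \<le> real (u_gen TYPE(real^2) conn n p)" by simp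
  then show ?thesis using klo by linarith
qed

text \<open>The quantifier over \<open>conn\<close> stands inside, so that a single threshold serves
  both u and its connected variant.\<close>

lemma u_gen_eventually_ge:
  fixes \<alpha> C \<delta> :: real and p :: "nat \<Rightarrow> real"
  assumes a: "0 < \<alpha>" "\<alpha> < 1/2" "0 < \<delta>" "\<delta> < \<alpha>" "4 * \<delta> \<le> 1 - 2 * \<alpha>" and C: "C > 0"
    and pC: "\<forall>\<^sub>F n in sequentially. 1 < p n * real n powr \<alpha> \<and> p n * real n powr \<alpha> < C"
  shows "\<forall>\<^sub>F n in sequentially. \<forall>conn.
    (2 - 2 * \<alpha> - 4 * \<delta>) * ln (real n) / p n \<le> real (u_gen TYPE(real^2) conn n (p n))"
proof -
  \<comment> \<open>The small-overlap bound has exponent 2 \<alpha> + \<delta> - 1 + 2 \<tau>. With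
    \<delta> and 2 \<tau> both at most (1 - 2 \<alpha>) / 4 it is at most - (1 - 2 \<alpha>) /
    2.\<close>
  define \<tau> where "\<tau> = (1 - 2 * \<alpha>) / 8"
  define K where "K = 2 powr (1 / \<tau>)"
  have \<tau>: "0 < \<tau>" using a by (simp add: \<tau>_def)
  have K: "0 < K" by (simp add: K_def)
  have "((\<lambda>x::real. 4 * x powr (\<alpha> - \<delta>) * exp (- ((x powr (-\<alpha>) / 2) * (x powr (1 - \<alpha> + \<delta>) / 16 - 1)))) \<longlongrightarrow> 0) at_top"
    using a by real_asymp
  then have e1: "\<forall>\<^sub>F x in at_top. 4 * x powr (\<alpha> - \<delta>) * exp (- ((x powr (-\<alpha>) / 2) * (x powr (1 - \<alpha> + \<delta>) / 16 - 1))) < 1/20"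
    by (rule order_tendstoD) simp
  have e2: "\<forall>\<^sub>F x in at_top. C * x powr (-\<alpha>) \<le> 1/2" using a C by real_asymp
  have e3: "\<forall>\<^sub>F x in at_top. 8 * C * x powr (-\<delta>) \<le> 1" using a C by real_asymp
  have e4: "\<forall>\<^sub>F x in at_top. 4 * C * x powr (-\<alpha>) * ln x \<le> 1" using a C by real_asymp
  have e5: "\<forall>\<^sub>F x::real in at_top. 32 * x powr (\<alpha> - \<delta>) \<le> x" using a by real_asymp
  have e6: "\<forall>\<^sub>F x in at_top. exp (- (x powr (1 - 2 * \<alpha>) / 16)) \<le> 1/20" using a by real_asymp
  have e7: "\<forall>\<^sub>F x in at_top. 12 * x powr \<alpha> * ln x \<le> x" using a by real_asymp
  have e8: "\<forall>\<^sub>F x in at_top. 8 * (3 * x powr \<alpha> * ln x)\<^sup>2 * x powr (\<delta> - 1) * exp (\<tau> * (2 * ln x + 1)) \<le> 1/20"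
    using a \<tau>_def by real_asymp
  have e9: "\<forall>\<^sub>F x in at_top. K * (8 * (3 * x powr \<alpha> * ln x) * x powr (\<delta> - 1)) * exp ((1 - \<alpha> - 2 * \<delta>) * ln x + 2) \<le> 1/20"
    using a K by real_asymp
  have e10: "\<forall>\<^sub>F x::real in at_top. 8 \<le> x" "\<forall>\<^sub>F x::real in at_top. 1 \<le> ln x" by real_asymp+
  note ev = e1 e2 e3 e4 e5 e6 e7 e8 e9 e10
  note evn = ev[THEN eventually_compose_filterlim, OF filterlim_real_sequentially]
  show ?thesis
    using pC evn
  proof eventually_elim
    case (elim n)
    show ?case
    proof
      fix conn
      show "(2 - 2 * \<alpha> - 4 * \<delta>) * ln (real n) / p n \<le> real (u_gen TYPE(real^2) conn n (p n))"
        by (rule u_gen_lower_bound[OF a \<tau>, where C = C]) (use elim in \<open>simp_all add: K_def\<close>)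
    qed
  qed
qed

theorem theorem18:
  fixes \<alpha> C :: real and p :: "nat \<Rightarrow> real"
  assumes "0 < \<alpha>" and "\<alpha> < 1/2" and "C > 0"
    and "\<forall>\<^sub>F n in sequentially. 1 < p n * real n powr \<alpha> \<and> p n * real n powr \<alpha> < C"
  shows "\<forall>\<epsilon>>0. \<exists>n0. \<forall>n\<ge>n0.
           real (u_d TYPE(real^2) n (p n)) \<ge> (2 - 2*\<alpha> - \<epsilon>) * ln (real n) / p n \<and>
           real (u_d' TYPE(real^2) n (p n)) \<ge> (2 - 2*\<alpha> - \<epsilon>) * ln (real n) / p n"
proof (intro allI impI)
  fix \<epsilon> :: real assume \<epsilon>: "\<epsilon> > 0"
  \<comment> \<open>\<epsilon> / 4 because the rate loses 4 \<delta>, \<alpha> / 2 so that the cycle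
    length grows, (1 - 2 \<alpha>) / 4 for the small overlaps.\<close>
  define \<delta> where "\<delta> = Min {\<epsilon> / 4, \<alpha> / 2, (1 - 2 * \<alpha>) / 4}"
  have \<delta>: "0 < \<delta>" "\<delta> \<le> \<epsilon> / 4" "\<delta> < \<alpha>" "4 * \<delta> \<le> 1 - 2 * \<alpha>"
    using \<epsilon> assms(1,2) by (auto simp: \<delta>_def min_def)
  have "\<forall>\<^sub>F n in sequentially. \<forall>conn.
      (2 - 2 * \<alpha> - \<epsilon>) * ln (real n) / p n \<le> real (u_gen TYPE(real^2) conn n (p n))"
    using u_gen_eventually_ge[OF assms(1,2) \<delta>(1,3,4) assms(3,4)] assms(4) eventually_ge_at_top[of 1]
  proof eventually_elim
    case (elim n)
    \<comment> \<open>Lowering the rate from 4 \<delta> to \<epsilon> lowers the bound only if ln n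
      / p is nonnegative.\<close>
    have "0 < p n" using elim(2) zero_less_mult_iff[of "p n" "real n powr \<alpha>"] by (smt (verit) powr_ge_zero)
    moreover have "0 \<le> ln (real n)" using elim(3) by simp
    ultimately have "(2 - 2 * \<alpha> - \<epsilon>) * ln (real n) / p n \<le> (2 - 2 * \<alpha> - 4 * \<delta>) * ln (real n) / p n"
      using \<delta>(2) by (intro divide_right_mono mult_right_mono) auto
    then show ?case using elim(1) by (auto intro: order_trans)
  qed
  then obtain n0 where "\<And>n conn. n \<ge> n0 \<Longrightarrow>
      (2 - 2 * \<alpha> - \<epsilon>) * ln (real n) / p n \<le> real (u_gen TYPE(real^2) conn n (p n))"
    unfolding eventually_sequentially by blast
  then show "\<exists>n0. \<forall>n\<ge>n0.
           real (u_d TYPE(real^2) n (p n)) \<ge> (2 - 2*\<alpha> - \<epsilon>) * ln (real n) / p n \<and>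
           real (u_d' TYPE(real^2) n (p n)) \<ge> (2 - 2*\<alpha> - \<epsilon>) * ln (real n) / p n"
    by blast
qed

end
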